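(* For every $n\ge1$ the stellohedra and permutohedra satisfy $$\gamma(St^n)=\gamma(St^{n-1})+\tau\sum_{i=1}^{n-1}\binom{n-1}{i-1}\gamma(St^{i-1})\,\gamma(Pe^{n-i-1}),$$ $$H(St^n)=(\alpha+t)H(St^{n-1})+\alpha t\sum_{i=1}^{n-1}\binom{n-1}{i-1}H(St^{i-1})\,H(Pe^{n-i-1}).$$
   Context: Notation: $[m]=\{1,\ldots,m\}$. For a simple graph $\Gamma$ on $[n+1]$, $B(\Gamma)$ is the collection of nonempty $S\subseteq[n+1]$ such that the induced subgraph $\Gamma|_S$ is connected. The graph-associahedron is the Minkowski sum $P_\Gamma=\sum_{S\in B(\Gamma)}\mathrm{conv}\{e_i : i\in S\}\subset\mathbb{R}^{n+1}$, with $e_i$ the standard basis vectors; for connected $\Gamma$ it is a simple polytope of dimension $n$. The permutohedron is $Pe^n=P_{K_{n+1}}$, where $K_{n+1}$ is the complete graph on $[n+1]$. The stellohedron is $St^n=P_{K_{1,n}}$, where $K_{1,n}$ is the star graph on $[n+1]$ (one node adjacent to the other $n$ nodes, no other edges). $St^0$ and $Pe^0$ are points. For a $d$-dimensional simple polytope $P$, let $f_i$ be the number of its $i$-dimensional faces ($f_d=1$), $F(P)(\alpha,t)=\sum_{i=0}^d f_i\alpha^i t^{d-i}$ and $H(P)(\alpha,t)=F(P)(\alpha-t,t)$. By the Dehn–Sommerville equations $H(P)$ is symmetric, so it is uniquely written as $H(P)=\sum_{i=0}^{\lfloor d/2\rfloor}\gamma_i(\alpha t)^i(\alpha+t)^{d-2i}$;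 the $\gamma$-polynomial is $\gamma(P)(\tau)=\sum_{i=0}^{\lfloor d/2\rfloor}\gamma_i\tau^i$. For a point, $H=\gamma=1$. Empty sums are $0$. *)

theory Defs
  imports
    "HOL-Analysis.Analysis"
    "HOL-Analysis.Finite_Function_Topology"
    "HOL-Library.Set_Algebras"
    "HOL-Computational_Algebra.Polynomial"
begin

text \<open>
  A simple graph on \<open>[m] = {1..m}\<close> is given by its edge relation, a symmetric and irreflexive
  subset of \<open>{1..m} \<times> {1..m}\<close>.
\<close>

definition simple_graph_on :: "nat set \<Rightarrow> (nat \<times> nat) set \<Rightarrow> bool"
  where "simple_graph_on V E \<longleftrightarrow> E \<subseteq> V \<times> V \<and> sym E \<and> irrefl E"

definition induced_connected :: "(nat \<times> nat) set \<Rightarrow> nat set \<Rightarrow> bool"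
  where "induced_connected E S \<longleftrightarrow> (\<forall>u\<in>S. \<forall>v\<in>S. (u, v) \<in> (E \<inter> S \<times> S)\<^sup>*)"

definition building_set :: "nat \<Rightarrow> (nat \<times> nat) set \<Rightarrow> nat set set"
  where "building_set m E = {S. S \<noteq> {} \<and> S \<subseteq> {1..m} \<and> induced_connected E S}"

definition complete_graph :: "nat \<Rightarrow> (nat \<times> nat) set"
  where "complete_graph m = {(i, j). i \<in> {1..m} \<and> j \<in> {1..m} \<and> i \<noteq> j}"

text \<open>The centre of the star on \<open>{1..m}\<close> is the node 1.\<close>

definition star_graph :: "nat \<Rightarrow> (nat \<times> nat) set"
  where "star_graph m =
    {(i, j). i \<in> {1..m} \<and> j \<in> {1..m} \<and> i \<noteq> j \<and> (i = 1 \<or> j = 1)}"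

lemma simple_complete_graph: "simple_graph_on {1..m} (complete_graph m)"
  by (auto simp: simple_graph_on_def complete_graph_def sym_def irrefl_def)

lemma simple_star_graph: "simple_graph_on {1..m} (star_graph m)"
  by (auto simp: simple_graph_on_def star_graph_def sym_def irrefl_def)

text \<open>
  The spaces \<open>\<real>\<^sup>m\<close> for varying \<open>m\<close> all live in the space \<open>nat \<Rightarrow>\<^sub>0 real\<close> of finitely supported
  sequences, with \<open>\<real>\<^sup>m\<close> the span of \<open>e\<^sub>1, \<dots>, e\<^sub>m\<close>. Faces and their dimensions do not depend on
  the ambient space. The sum below is the Minkowski sum of sets.
\<close>

definition graph_associahedron :: "nat \<Rightarrow> (nat \<times> nat) set \<Rightarrow> (nat \<Rightarrow>\<^sub>0 real) set"
  where "graph_associahedron m E =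
    (\<Sum>S\<in>building_set m E. convex hull ((\<lambda>i. Poly_Mapping.single i 1) ` S))"

definition permutohedron :: "nat \<Rightarrow> (nat \<Rightarrow>\<^sub>0 real) set"
  where "permutohedron n = graph_associahedron (n + 1) (complete_graph (n + 1))"

definition stellohedron :: "nat \<Rightarrow> (nat \<Rightarrow>\<^sub>0 real) set"
  where "stellohedron n = graph_associahedron (n + 1) (star_graph (n + 1))"

text \<open>
  The library's \<^const>\<open>aff_dim\<close> is restricted to Euclidean spaces, so the dimension of a nonempty
  convex set is taken as the linear dimension of the space spanned by its differences.
\<close>

definition convex_dim :: "'a::real_vector set \<Rightarrow> nat"
  where "convex_dim S = dim {x - y | x y. x \<in> S \<and> y \<in> S}"

definition face_number :: "'a::real_vector set \<Rightarrow> nat \<Rightarrow> nat"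
  where "face_number P i = card {F. F face_of P \<and> F \<noteq> {} \<and> convex_dim F = i}"

text \<open>
  Polynomials in \<open>\<alpha>\<close> and \<open>t\<close> are polynomials in \<open>\<alpha>\<close> over the polynomials in \<open>t\<close>; hence the
  substitution of \<open>\<alpha> - t\<close> for \<open>\<alpha>\<close> is a \<^const>\<open>pcompose\<close>.
\<close>

definition var_alpha :: "int poly poly"
  where "var_alpha = [:0, 1:]"

definition var_t :: "int poly poly"
  where "var_t = [:[:0, 1:]:]"

definition F_poly :: "'a::real_vector set \<Rightarrow> int poly poly"
  where "F_poly P =
    (\<Sum>i\<le>convex_dim P. of_nat (face_number P i) * var_alpha ^ i * var_t ^ (convex_dim P - i))"

definition H_poly :: "'a::real_vector set \<Rightarrow> int poly poly"
  where "H_poly P = pcompose (F_poly P) (var_alpha - var_t)"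

text \<open>
  The description determines the polynomial uniquely if it exists, which it does for simple
  polytopes by the Dehn--Sommerville equations. The constant \<open>[:[:c:]:]\<close> is \<open>c\<close> seen as a
  polynomial in \<open>\<alpha>\<close> and \<open>t\<close>.
\<close>

definition gamma_poly :: "'a::real_vector set \<Rightarrow> int poly"
  where "gamma_poly P = (THE g.
    degree g \<le> convex_dim P div 2 \<and>
    H_poly P = (\<Sum>i\<le>convex_dim P div 2.
      [:[:coeff g i:]:] * (var_alpha * var_t) ^ i * (var_alpha + var_t) ^ (convex_dim P - 2 * i)))"

definition var_tau :: "int poly"
  where "var_tau = [:0, 1:]"

end

theory Submission
  imports Defs "HOL-Computational_Algebra.Formal_Power_Series"
begin

text \<open>
  Both polytopes are Minkowski sums of simplices over the same kind of family: all nonempty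
  subsets of \<open>V\<close> that contain a fixed set \<open>D\<close>, together with the singletons. Here \<open>D\<close> is empty
  for the permutohedron, and \<open>D\<close> consists of the centre for the stellohedron, since a set of two
  or more nodes of a star is connected exactly if it contains the centre.

  A face of a sum of simplices is a sum of subsimplices, so it selects a nonempty \<open>T S \<subseteq> S\<close> in
  every summand. If \<open>i\<close> and \<open>j\<close> belong to two of the sets, then a vertex \<open>e\<^sub>i\<close> of one simplex
  and a vertex \<open>e\<^sub>j\<close> of the other can be swapped without changing their sum, and this forces on
  \<open>T\<close> the weak axiom of revealed preference from the theory of choice. As in that theory, \<open>T\<close> is
  therefore given by a weight function \<open>w\<close>: the set \<open>T S\<close> consists of the elements of \<open>S\<close> of
  largest weight (\<open>choice_rationalisable\<close>). Conversely every weight function cuts out a face.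
  Only the order of the weights matters, and in the star case all leaves that weigh less than
  the centre may be given the same weight; so faces correspond to canonical weights, which use
  the values \<open>1, \<dots>, K\<close> without gaps, with the value 0 for leaves below the centre. A face has as
  codimension in \<open>\<real>\<^sup>V\<close> the number of positive values plus the number of elements of value 0
  (\<open>F_poly_eq\<close>).

  Canonical weights are functions that cover a prescribed set of values, and inclusion and
  exclusion yields exponential generating functions for the numbers \<open>F(a, t)\<close>, where \<open>Pe\<^sup>n\<close>
  belongs to \<open>x\<^sup>n\<^sup>+\<^sup>1\<close> and \<open>St\<^sup>n\<close> to \<open>x\<^sup>n\<close>. With \<open>u = (exp (a x) - 1) / a\<close> they are \<open>p = u / (1
  - t u)\<close> for the permutohedra and \<open>s = exp ((a + t) x) / (1 - t u)\<close> for the stellohedra, and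
  they satisfy \<open>p' = (1 + t p) (1 + (a + t) p)\<close> and \<open>s' = s ((a + 2 t) + t (a + t) p)\<close>
  (\<open>chain_egf_ode\<close>). Comparing coefficients and replacing \<open>a\<close> by \<open>a - t\<close> turns the second
  equation into the recursion for \<open>H(St\<^sup>n)\<close>. The first one becomes a similar recursion for
  \<open>H(Pe\<^sup>n)\<close>.

  If \<open>g\<close> has degree at most \<open>d / 2\<close>, then it is the \<open>\<gamma>\<close>-polynomial of \<open>H\<close> in dimension \<open>d\<close> if
  and only if \<open>H(a, t) = (a + t)\<^sup>d g(a t / (a + t)\<^sup>2)\<close>. Hence the recursions for \<open>H\<close> produce
  \<open>\<gamma>\<close>-expansions of all these polytopes by induction, and with them the recursion for \<open>\<gamma>\<close>
  (\<open>gamma_expansion_recursion\<close>).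
\<close>

section \<open>Sums of simplices\<close>

abbreviation unit_vec :: "'a \<Rightarrow> ('a \<Rightarrow>\<^sub>0 real)"
  where "unit_vec i \<equiv> Poly_Mapping.single i 1"

abbreviation simplex_on :: "'a set \<Rightarrow> ('a \<Rightarrow>\<^sub>0 real) set"
  where "simplex_on S \<equiv> convex hull (unit_vec ` S)"

lemma lookup_scaleR [simp]:
  "Poly_Mapping.lookup (r *\<^sub>R x) i = r *\<^sub>R Poly_Mapping.lookup x i"
  by (simp add: scaleR_poly_mapping_def)

lemma lookup_unit_vec: "Poly_Mapping.lookup (unit_vec i) j = (if i = j then 1 else 0)"
  by (simp add: lookup_single when_def)

lemma unit_vec_expansion:
  assumes "finite S" "\<And>i. i \<notin> S \<Longrightarrow> Poly_Mapping.lookup x i = 0"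
  shows "(\<Sum>i\<in>S. Poly_Mapping.lookup x i *\<^sub>R unit_vec i) = x"
proof (rule poly_mapping_eqI)
  fix k
  show "Poly_Mapping.lookup (\<Sum>i\<in>S. Poly_Mapping.lookup x i *\<^sub>R unit_vec i) k = Poly_Mapping.lookup x k"
    using assms by (simp add: lookup_sum lookup_unit_vec if_distrib[of "\<lambda>r. _ * r"] cong: if_cong)
qed

lemma simplex_on_iff:
  assumes "finite S"
  shows "x \<in> simplex_on S \<longleftrightarrow>
    (\<forall>i. 0 \<le> Poly_Mapping.lookup x i) \<and> (\<forall>i. i \<notin> S \<longrightarrow> Poly_Mapping.lookup x i = 0) \<and>
    (\<Sum>i\<in>S. Poly_Mapping.lookup x i) = 1" (is "_ \<longleftrightarrow> ?Q x")
proof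
  have "convex {x. ?Q x}"
    by (auto simp: convex_def lookup_add sum.distrib simp flip: sum_distrib_left)
  moreover have "unit_vec ` S \<subseteq> {x. ?Q x}"
    using assms by (auto simp: lookup_unit_vec)
  ultimately have "simplex_on S \<subseteq> {x. ?Q x}"
    by (rule hull_minimal[rotated])
  then show "x \<in> simplex_on S \<Longrightarrow> ?Q x" by blast
next
  assume Q: "?Q x"
  have "(\<Sum>i\<in>S. Poly_Mapping.lookup x i *\<^sub>R unit_vec i) \<in> simplex_on S"
    using Q assms by (intro convex_sum) (auto intro: hull_inc)
  then show "x \<in> simplex_on S"
    using Q assms by (simp add: unit_vec_expansion)
qed

section \<open>Faces cut out by weights\<close>

definition maximisers :: "('a \<Rightarrow> nat) \<Rightarrow> 'a set \<Rightarrow> 'a set"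
  where "maximisers w S = {i\<in>S. \<forall>j\<in>S. w j \<le> w i}"

lemma maximisers_subset: "maximisers w S \<subseteq> S"
  by (auto simp: maximisers_def)

lemma maximisers_nonempty:
  assumes "finite S" "S \<noteq> {}" shows "maximisers w S \<noteq> {}"
proof -
  have "Max (w ` S) \<in> w ` S"
    using assms by (intro Max_in) auto
  then obtain i where i: "Max (w ` S) = w i" "i \<in> S"
    by (rule imageE)
  have "w j \<le> w i" if "j \<in> S" for j
    using that assms i(1) Max_ge[of "w ` S" "w j"] by simp
  with i(2) show ?thesis by (auto simp: maximisers_def)
qed

locale simplex_sum =
  fixes V :: "'a set" and B :: "'a set set"
  assumes finite_V: "finite V"
    and B_subset: "S \<in> B \<Longrightarrow> S \<subseteq> V"
    and B_nonempty: "S \<in> B \<Longrightarrow> S \<noteq> {}"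
begin

lemma finite_B: "finite B"
  using finite_V B_subset by (meson Pow_iff finite_Pow_iff finite_subset subsetI)

lemma finite_member: "S \<in> B \<Longrightarrow> finite S"
  using finite_V B_subset finite_subset by blast

definition sum_polytope :: "('a set \<Rightarrow> 'a set) \<Rightarrow> ('a \<Rightarrow>\<^sub>0 real) set"
  where "sum_polytope T = (\<Sum>S\<in>B. simplex_on (T S))"

text \<open>A point of the sum is the sum of one point from each summand; the proofs work with these
  selections and not with the sum itself, because faces can be exchanged summand by summand.\<close>

definition selections :: "('a set \<Rightarrow> 'a set) \<Rightarrow> ('a set \<Rightarrow> ('a \<Rightarrow>\<^sub>0 real)) set"
  where "selections T = {z. \<forall>S\<in>B. z S \<in> simplex_on (T S)}"

lemma sum_polytope_eq: "sum_polytope T = (\<lambda>z. \<Sum>S\<in>B. z S) ` selections T"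
  unfolding sum_polytope_def selections_def using finite_B by (auto simp: set_sum_alt)

lemma selections_mono: "(\<And>S. S \<in> B \<Longrightarrow> T S \<subseteq> T' S) \<Longrightarrow> selections T \<subseteq> selections T'"
  unfolding selections_def
  by (intro Collect_mono impI ballI) (metis hull_mono image_mono subsetD)

definition height :: "('a \<Rightarrow> nat) \<Rightarrow> ('a \<Rightarrow>\<^sub>0 real) \<Rightarrow> real"
  where "height w x = (\<Sum>i\<in>V. w i * Poly_Mapping.lookup x i)"

lemma height_linear: "linear (height w)"
  by (rule linearI) (simp_all add: height_def lookup_add algebra_simps sum.distrib sum_distrib_left)

definition top_height :: "('a \<Rightarrow> nat) \<Rightarrow> 'a set \<Rightarrow> real"
  where "top_height w S = Max (w ` S)"

text \<open>The height of \<open>x\<close> is an average of the weights of the vertices of the simplex, with the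
  coordinates of \<open>x\<close> as coefficients. It reaches the maximum only if all coordinates at vertices of
  smaller weight vanish.\<close>

lemma height_le_top:
  assumes "S \<in> B" "x \<in> simplex_on S"
  shows "height w x \<le> top_height w S"
    and "height w x = top_height w S \<longleftrightarrow> x \<in> simplex_on (maximisers w S)"
proof -
  let ?l = "Poly_Mapping.lookup x" and ?M = "top_height w S"
  note fS = finite_member[OF assms(1)]
  have l: "\<And>i. 0 \<le> ?l i" "\<And>i. i \<notin> S \<Longrightarrow> ?l i = 0" "(\<Sum>i\<in>S. ?l i) = 1"
    using assms(2) fS by (auto simp: simplex_on_iff)
  have le: "w i \<le> ?M" if "i \<in> S" for i
    using that fS by (simp add: top_height_def)
  have "height w x = (\<Sum>i\<in>S. w i * ?l i)"
    unfolding height_def using finite_V B_subset[OF assms(1)] l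
    by (intro sum.mono_neutral_right) auto
  moreover have "(\<Sum>i\<in>S. (?M - w i) * ?l i) = ?M * (\<Sum>i\<in>S. ?l i) - (\<Sum>i\<in>S. w i * ?l i)"
    by (simp only: left_diff_distrib sum_subtractf sum_distrib_left)
  ultimately have diff: "?M - height w x = (\<Sum>i\<in>S. (?M - w i) * ?l i)"
    using l(3) by simp
  have nonneg: "0 \<le> (?M - w i) * ?l i" if "i \<in> S" for i
    using le[OF that] l(1) by simp
  show "height w x \<le> ?M"
    using sum_nonneg[of S "\<lambda>i. (?M - w i) * ?l i"] nonneg diff by simp
  have max_iff: "i \<in> maximisers w S \<longleftrightarrow> ?M = w i" if "i \<in> S" for i
  proof -
    have "?M = w i \<longleftrightarrow> Max (w ` S) = w i" by (simp add: top_height_def)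
    also have "\<dots> \<longleftrightarrow> (\<forall>j\<in>S. w j \<le> w i)"
      using fS that Max_eq_iff[of "w ` S" "w i"] by auto
    finally show ?thesis using that by (auto simp: maximisers_def)
  qed
  have fm: "finite (maximisers w S)" using fS maximisers_subset finite_subset by metis
  have "height w x = ?M \<longleftrightarrow> (\<Sum>i\<in>S. (?M - w i) * ?l i) = 0"
    using diff by auto
  also have "\<dots> \<longleftrightarrow> (\<forall>i\<in>S. (?M - w i) * ?l i = 0)"
    using fS nonneg by (intro sum_nonneg_eq_0_iff) auto
  also have "\<dots> \<longleftrightarrow> (\<forall>i. i \<notin> maximisers w S \<longrightarrow> ?l i = 0)"
    using max_iff l(2) maximisers_subset[of w S] by fastforce
  also have "\<dots> \<longleftrightarrow> x \<in> simplex_on (maximisers w S)"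
  proof
    assume z: "\<forall>i. i \<notin> maximisers w S \<longrightarrow> ?l i = 0"
    have "(\<Sum>i\<in>maximisers w S. ?l i) = (\<Sum>i\<in>S. ?l i)"
      using fS maximisers_subset[of w S] z by (intro sum.mono_neutral_left) auto
    then show "x \<in> simplex_on (maximisers w S)"
      using z l fm by (simp add: simplex_on_iff)
  qed (use fm in \<open>simp add: simplex_on_iff\<close>)
  finally show "height w x = ?M \<longleftrightarrow> x \<in> simplex_on (maximisers w S)" .
qed

lemma height_selection:
  assumes "z \<in> selections id"
  shows "height w (\<Sum>S\<in>B. z S) \<le> (\<Sum>S\<in>B. top_height w S)"
    and "height w (\<Sum>S\<in>B. z S) = (\<Sum>S\<in>B. top_height w S) \<longleftrightarrow> z \<in> selections (maximisers w)"
proof -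
  have z: "\<And>S. S \<in> B \<Longrightarrow> z S \<in> simplex_on S" using assms by (simp add: selections_def)
  have h: "height w (\<Sum>S\<in>B. z S) = (\<Sum>S\<in>B. height w (z S))"
    by (rule linear_sum[OF height_linear])
  show "height w (\<Sum>S\<in>B. z S) \<le> (\<Sum>S\<in>B. top_height w S)"
    unfolding h by (intro sum_mono height_le_top z)
  have "height w (\<Sum>S\<in>B. z S) = (\<Sum>S\<in>B. top_height w S) \<longleftrightarrow>
      (\<Sum>S\<in>B. top_height w S - height w (z S)) = 0"
    unfolding h by (auto simp: sum_subtractf)
  also have "\<dots> \<longleftrightarrow> (\<forall>S\<in>B. top_height w S - height w (z S) = 0)"
    using finite_B height_le_top(1) z by (intro sum_nonneg_eq_0_iff) auto
  also have "\<dots> \<longleftrightarrow> z \<in> selections (maximisers w)"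
    unfolding selections_def mem_Collect_eq
  proof (rule ball_cong[OF refl])
    fix S assume "S \<in> B"
    then show "top_height w S - height w (z S) = 0 \<longleftrightarrow> z S \<in> simplex_on (maximisers w S)"
      using height_le_top(2)[of S "z S" w] z by auto
  qed
  finally show "height w (\<Sum>S\<in>B. z S) = (\<Sum>S\<in>B. top_height w S) \<longleftrightarrow> z \<in> selections (maximisers w)" .
qed

lemma maximisers_selection: "z \<in> selections (maximisers w) \<Longrightarrow> z \<in> selections id"
  using selections_mono[of "maximisers w" id] maximisers_subset[of w] unfolding id_apply by blast

lemma weight_face_eq:
  "sum_polytope (maximisers w) =
    {x \<in> sum_polytope id. height w x = (\<Sum>S\<in>B. top_height w S)}"
  unfolding sum_polytope_eq using height_selection(2) maximisers_selection by blast

lemma convex_sum_polytope: "convex (sum_polytope T)"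
  unfolding sum_polytope_def by (intro convex_set_sum) auto

lemma weight_face_face_of: "sum_polytope (maximisers w) face_of sum_polytope id"
  unfolding face_of_def
proof (intro conjI ballI impI)
  show "sum_polytope (maximisers w) \<subseteq> sum_polytope id"
    using weight_face_eq by blast
  show "convex (sum_polytope (maximisers w))" by (rule convex_sum_polytope)
  fix a b x assume a: "a \<in> sum_polytope id" and b: "b \<in> sum_polytope id"
    and x: "x \<in> sum_polytope (maximisers w)" and seg: "x \<in> open_segment a b"
  let ?M = "\<Sum>S\<in>B. top_height w S"
  have le: "height w a \<le> ?M" "height w b \<le> ?M"
    using a b height_selection(1) unfolding sum_polytope_eq by auto
  obtain u where u: "0 < u" "u < 1" "x = (1 - u) *\<^sub>R a + u *\<^sub>R b"
    using seg by (auto simp: in_segment)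
  have eq: "(1 - u) * (?M - height w a) + u * (?M - height w b) = 0"
  proof -
    have "height w x = ?M" using x by (simp add: weight_face_eq)
    moreover have "height w x = (1 - u) * height w a + u * height w b"
      unfolding u(3) by (simp add: linear_add[OF height_linear] linear_scale[OF height_linear])
    ultimately show ?thesis by (simp add: algebra_simps)
  qed
  have "0 \<le> (1 - u) * (?M - height w a)" "0 \<le> u * (?M - height w b)"
    using u le by auto
  with eq have "(1 - u) * (?M - height w a) = 0" "u * (?M - height w b) = 0"
    by linarith+
  then have "height w a = ?M" "height w b = ?M" using u by auto
  then show "a \<in> sum_polytope (maximisers w)" "b \<in> sum_polytope (maximisers w)"
    using a b by (auto simp: weight_face_eq)
qed

lemma vertex_selection_exists:
  assumes "\<And>S. S \<in> B \<Longrightarrow> T S \<noteq> {}" "S \<in> B" "i \<in> T S"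
  obtains z where "z \<in> selections T" "z S = unit_vec i"
proof
  let ?z = "\<lambda>R. if R = S then unit_vec i else unit_vec (SOME j. j \<in> T R)"
  show "?z \<in> selections T"
    using assms by (auto simp: selections_def some_in_eq intro!: hull_inc)
qed auto

lemma unit_vec_in_simplex_on: "finite S \<Longrightarrow> unit_vec i \<in> simplex_on S \<longleftrightarrow> i \<in> S"
proof
  assume "finite S" "unit_vec i \<in> simplex_on S"
  then show "i \<in> S" by (metis lookup_single_eq simplex_on_iff zero_neq_one)
qed (auto intro: hull_inc)

text \<open>A point of \<open>\<Sum>\<Delta>\<^sub>S\<close> of maximal height has maximal height in every summand, no matter how it is
  decomposed. So the face knows which vertices of each summand it uses.\<close>

lemma weight_face_eqD:
  assumes eq: "sum_polytope (maximisers w) = sum_polytope (maximisers w')" and S: "S \<in> B"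
  shows "maximisers w S = maximisers w' S"
proof -
  have "maximisers w S \<subseteq> maximisers w' S"
    if eq: "sum_polytope (maximisers w) = sum_polytope (maximisers w')" for w w'
  proof
    fix i assume i: "i \<in> maximisers w S"
    obtain z where z: "z \<in> selections (maximisers w)" "z S = unit_vec i"
      using vertex_selection_exists[of "maximisers w" S i] S i
        maximisers_nonempty finite_member B_nonempty by metis
    have "(\<Sum>S\<in>B. z S) \<in> sum_polytope (maximisers w')"
      using z(1) eq sum_polytope_eq by blast
    then have "z \<in> selections (maximisers w')"
      using z maximisers_selection height_selection(2) weight_face_eq by auto
    then have "unit_vec i \<in> simplex_on (maximisers w' S)"
      using z S by (auto simp: selections_def)
    moreover have "finite (maximisers w' S)"
      using finite_member[OF S] maximisers_subset finite_subset by metis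
    ultimately show "i \<in> maximisers w' S"
      by (simp add: unit_vec_in_simplex_on)
  qed
  then show ?thesis using eq by auto
qed

end

context simplex_sum
begin

section \<open>Every face is cut out by weights\<close>

definition face_choice :: "('a \<Rightarrow>\<^sub>0 real) set \<Rightarrow> 'a set \<Rightarrow> 'a set"
  where "face_choice F S =
    {i\<in>S. \<exists>z\<in>selections id. (\<Sum>R\<in>B. z R) \<in> F \<and> z S = unit_vec i}"

lemma face_choice_subset: "face_choice F S \<subseteq> S"
  by (auto simp: face_choice_def)

context
  fixes F
  assumes face: "F face_of sum_polytope id"
begin

lemma face_halves:
  assumes "a \<in> sum_polytope id" "b \<in> sum_polytope id" "0 < u" "u < 1"
    "(1 - u) *\<^sub>R a + u *\<^sub>R b \<in> F"
  shows "a \<in> F" "b \<in> F"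
proof -
  have "a \<in> F \<and> b \<in> F"
  proof (cases "a = b")
    case True
    then show ?thesis using assms(5) by (simp flip: scaleR_left_distrib)
  next
    case False
    then have "(1 - u) *\<^sub>R a + u *\<^sub>R b \<in> open_segment a b"
      using assms by (auto simp: in_segment)
    then show ?thesis using face_ofD[OF face] assms by blast
  qed
  then show "a \<in> F" "b \<in> F" by auto
qed

lemma selection_sum_in: "z \<in> selections id \<Longrightarrow> (\<Sum>R\<in>B. z R) \<in> sum_polytope id"
  by (auto simp: sum_polytope_eq)

text \<open>The two selections obtained from \<open>x\<close> and \<open>y\<close> by exchanging the summand \<open>S\<close> have the same
  midpoint as \<open>x\<close> and \<open>y\<close>. This midpoint lies in the face, hence so do the exchanged points. In
  consequence a face contains all combinations of its projections to the summands.\<close>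

lemma face_mix:
  assumes x: "x \<in> selections id" "(\<Sum>R\<in>B. x R) \<in> F"
    and y: "y \<in> selections id" "(\<Sum>R\<in>B. y R) \<in> F"
  shows "(\<Sum>R\<in>B. (x(S := y S)) R) \<in> F"
proof -
  let ?z = "x(S := y S)" and ?z' = "y(S := x S)"
  have sel: "?z \<in> selections id" "?z' \<in> selections id"
    using x y by (auto simp: selections_def)
  have "?z R + ?z' R = x R + y R" for R by (simp add: add.commute)
  then have eq: "(\<Sum>R\<in>B. ?z R) + (\<Sum>R\<in>B. ?z' R) = (\<Sum>R\<in>B. x R) + (\<Sum>R\<in>B. y R)"
    by (simp flip: sum.distrib)
  have "(1 - 1/2) *\<^sub>R (\<Sum>R\<in>B. x R) + (1/2) *\<^sub>R (\<Sum>R\<in>B. y R) \<in> F"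
    using x y face_of_imp_convex[OF face] by (intro convexD_alt) auto
  also have "(1 - 1/2) *\<^sub>R (\<Sum>R\<in>B. x R) + (1/2) *\<^sub>R (\<Sum>R\<in>B. y R) =
      (1 - 1/2) *\<^sub>R (\<Sum>R\<in>B. ?z R) + (1/2::real) *\<^sub>R (\<Sum>R\<in>B. ?z' R)"
    using eq by (simp flip: scaleR_right_distrib)
  finally show ?thesis
    using face_halves(1)[OF selection_sum_in[OF sel(1)] selection_sum_in[OF sel(2)], of "1/2"] by simp
qed

lemma face_combine:
  assumes "F \<noteq> {}"
    and z: "\<And>S. S \<in> B \<Longrightarrow> \<exists>x\<in>selections id. (\<Sum>R\<in>B. x R) \<in> F \<and> x S = z S"
  shows "(\<Sum>R\<in>B. z R) \<in> F"
proof -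
  have "\<exists>x\<in>selections id. (\<Sum>R\<in>B. x R) \<in> F \<and> (\<forall>S\<in>A. x S = z S)" if "A \<subseteq> B" for A
    using finite_subset[OF that finite_B] that
  proof (induction A rule: finite_induct)
    case empty
    obtain p where "p \<in> F" using assms(1) by auto
    moreover have "p \<in> sum_polytope id" using calculation face_of_imp_subset[OF face] by auto
    ultimately show ?case unfolding sum_polytope_eq by blast
  next
    case (insert S A)
    then obtain x where x: "x \<in> selections id" "(\<Sum>R\<in>B. x R) \<in> F" "\<forall>S\<in>A. x S = z S" by blast
    obtain y where y: "y \<in> selections id" "(\<Sum>R\<in>B. y R) \<in> F" "y S = z S"
      using z insert.prems by blast
    have "x(S := y S) \<in> selections id" using x y by (auto simp: selections_def)
    moreover have "\<forall>R\<in>insert S A. (x(S := y S)) R = z R"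
      using x y insert.hyps by auto
    ultimately show ?case using face_mix[OF x(1,2) y(1,2)] by blast
  qed
  from this[OF order_refl] obtain x where "(\<Sum>R\<in>B. x R) \<in> F" "\<forall>S\<in>B. x S = z S" by auto
  then show ?thesis by (metis (no_types, lifting) sum.cong)
qed

text \<open>If the \<open>S\<close>-component has a positive coordinate at \<open>i\<close> and is not \<open>e\<^sub>i\<close> itself, then it lies on an open segment from
  \<open>e\<^sub>i\<close> to another point of the simplex, and the defining property of a face moves the component
  to the end point \<open>e\<^sub>i\<close>.\<close>

lemma face_choice_support:
  assumes x: "x \<in> selections id" "(\<Sum>R\<in>B. x R) \<in> F" and S: "S \<in> B"
    and pos: "Poly_Mapping.lookup (x S) i > 0"
  shows "i \<in> face_choice F S"
proof -
  let ?l = "Poly_Mapping.lookup (x S)"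
  have fS: "finite S" by (rule finite_member[OF S])
  have xS: "x S \<in> simplex_on S" using x(1) S by (simp add: selections_def)
  then have l: "\<And>i. 0 \<le> ?l i" "\<And>i. i \<notin> S \<Longrightarrow> ?l i = 0" "(\<Sum>i\<in>S. ?l i) = 1"
    using fS by (auto simp: simplex_on_iff)
  have i: "i \<in> S" using pos l(2) by fastforce
  have sum: "?l i + (\<Sum>j\<in>S - {i}. ?l j) = 1"
    using l(3) sum.remove[OF fS i, of ?l] by simp
  show ?thesis
  proof (cases "?l i = 1")
    case True
    then have "(\<Sum>j\<in>S - {i}. ?l j) = 0" using sum by simp
    then have "\<forall>j\<in>S - {i}. ?l j = 0"
      using fS l(1) by (subst (asm) sum_nonneg_eq_0_iff) auto
    then have "x S = unit_vec i"
      using l(2) True by (intro poly_mapping_eqI) (auto simp: lookup_unit_vec)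
    then show ?thesis using x i by (auto simp: face_choice_def)
  next
    case False
    define u where "u = 1 - ?l i"
    have "0 \<le> (\<Sum>j\<in>S - {i}. ?l j)" using l(1) by (simp add: sum_nonneg)
    then have u: "0 < u" "u < 1" using False sum pos by (auto simp: u_def)
    define y where "y = (1/u) *\<^sub>R (x S - ?l i *\<^sub>R unit_vec i)"
    have ly: "Poly_Mapping.lookup y j = (if j = i then 0 else ?l j / u)" for j
      by (simp add: y_def lookup_minus lookup_unit_vec)
    have "(\<Sum>j\<in>S. Poly_Mapping.lookup y j) = (\<Sum>j\<in>S - {i}. ?l j / u)"
      unfolding ly sum.remove[OF fS i] by simp
    also have "\<dots> = 1" using sum u by (simp add: u_def flip: sum_divide_distrib)
    finally have y: "y \<in> simplex_on S"
      using fS l u i by (auto simp: simplex_on_iff ly)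
    have comb: "x S = (1 - u) *\<^sub>R unit_vec i + u *\<^sub>R y"
      using u by (simp add: y_def u_def)
    let ?a = "x(S := unit_vec i)" and ?b = "x(S := y)"
    have "unit_vec i \<in> simplex_on S" using i by (intro hull_inc) auto
    then have sel: "?a \<in> selections id" "?b \<in> selections id"
      using x(1) y by (auto simp: selections_def)
    have "(1 - u) *\<^sub>R ?a R + u *\<^sub>R ?b R = x R" for R
      using comb by (simp flip: scaleR_left_distrib)
    then have "(1 - u) *\<^sub>R (\<Sum>R\<in>B. ?a R) + u *\<^sub>R (\<Sum>R\<in>B. ?b R) = (\<Sum>R\<in>B. x R)"
      by (simp add: scaleR_sum_right flip: sum.distrib)
    then have "(\<Sum>R\<in>B. ?a R) \<in> F"
      using face_halves(1)[OF selection_sum_in[OF sel(1)] selection_sum_in[OF sel(2)] u] x(2) by simp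
    then show ?thesis using sel(1) i unfolding face_choice_def
      by (intro CollectI conjI bexI[of _ ?a]) auto
  qed
qed

lemma face_choice_selection:
  assumes x: "x \<in> selections id" "(\<Sum>R\<in>B. x R) \<in> F"
  shows "x \<in> selections (face_choice F)"
  unfolding selections_def
proof (intro CollectI ballI)
  fix S assume S: "S \<in> B"
  let ?l = "Poly_Mapping.lookup (x S)" and ?T = "face_choice F S"
  have fS: "finite S" by (rule finite_member[OF S])
  have fT: "finite ?T" using fS face_choice_subset[of F S] finite_subset by blast
  have "x S \<in> simplex_on S" using x(1) S by (simp add: selections_def)
  then have l: "\<And>i. 0 \<le> ?l i" "\<And>i. i \<notin> S \<Longrightarrow> ?l i = 0" "(\<Sum>i\<in>S. ?l i) = 1"
    using fS by (auto simp: simplex_on_iff)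
  have z: "?l i = 0" if "i \<notin> ?T" for i
    using face_choice_support[OF x S, of i] that l(1)[of i] by fastforce
  have "(\<Sum>i\<in>?T. ?l i) = (\<Sum>i\<in>S. ?l i)"
    using fS face_choice_subset[of F S] z by (intro sum.mono_neutral_left) auto
  then show "x S \<in> simplex_on ?T"
    using fT l z by (simp add: simplex_on_iff)
qed

lemma face_choice_nonempty:
  assumes "F \<noteq> {}" "S \<in> B"
  shows "face_choice F S \<noteq> {}"
proof -
  obtain p where p: "p \<in> F" "p \<in> sum_polytope id"
    using assms(1) face_of_imp_subset[OF face] by auto
  then obtain x where "x \<in> selections id" "(\<Sum>R\<in>B. x R) \<in> F"
    by (auto simp: sum_polytope_eq)
  then have "x S \<in> simplex_on (face_choice F S)"
    using face_choice_selection assms(2) unfolding selections_def by blast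
  then show ?thesis by auto
qed

lemma face_choice_attained:
  assumes S: "S \<in> B" and y: "y \<in> simplex_on (face_choice F S)"
  shows "\<exists>x\<in>selections id. (\<Sum>R\<in>B. x R) \<in> F \<and> x S = y"
proof -
  let ?K = "{y. \<exists>x\<in>selections id. (\<Sum>R\<in>B. x R) \<in> F \<and> x S = y}"
  have "convex ?K"
  proof (rule convexI)
    fix a b and u v :: real
    assume "a \<in> ?K" "b \<in> ?K" and uv: "0 \<le> u" "0 \<le> v" "u + v = 1"
    then obtain x x' where x: "x \<in> selections id" "(\<Sum>R\<in>B. x R) \<in> F" "x S = a"
      and x': "x' \<in> selections id" "(\<Sum>R\<in>B. x' R) \<in> F" "x' S = b" by blast
    let ?z = "\<lambda>R. u *\<^sub>R x R + v *\<^sub>R x' R"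
    have "?z \<in> selections id"
      using x(1) x'(1) uv unfolding selections_def by (auto intro!: convexD)
    moreover have "(\<Sum>R\<in>B. ?z R) = u *\<^sub>R (\<Sum>R\<in>B. x R) + v *\<^sub>R (\<Sum>R\<in>B. x' R)"
      by (simp add: scaleR_sum_right sum.distrib)
    moreover have "u *\<^sub>R (\<Sum>R\<in>B. x R) + v *\<^sub>R (\<Sum>R\<in>B. x' R) \<in> F"
      using x x' uv face_of_imp_convex[OF face] by (intro convexD) auto
    ultimately show "u *\<^sub>R a + v *\<^sub>R b \<in> ?K"
      using x(3) x'(3) by (intro CollectI bexI[of _ ?z]) auto
  qed
  moreover have "unit_vec ` face_choice F S \<subseteq> ?K"
    by (auto simp: face_choice_def)
  ultimately have "simplex_on (face_choice F S) \<subseteq> ?K"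
    by (rule hull_minimal[rotated])
  then show ?thesis using y by blast
qed

lemma face_eq_sum_choice:
  assumes "F \<noteq> {}"
  shows "F = sum_polytope (face_choice F)"
proof
  show "F \<subseteq> sum_polytope (face_choice F)"
  proof
    fix p assume p: "p \<in> F"
    then have "p \<in> sum_polytope id" using face_of_imp_subset[OF face] by auto
    then obtain x where x: "x \<in> selections id" "p = (\<Sum>R\<in>B. x R)"
      by (auto simp: sum_polytope_eq)
    then show "p \<in> sum_polytope (face_choice F)"
      using face_choice_selection p sum_polytope_eq by auto
  qed
  show "sum_polytope (face_choice F) \<subseteq> F"
  proof
    fix p assume "p \<in> sum_polytope (face_choice F)"
    then obtain z where z: "z \<in> selections (face_choice F)" "p = (\<Sum>R\<in>B. z R)"
      by (auto simp: sum_polytope_eq)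
    then show "p \<in> F"
      using face_combine[OF assms, of z] face_choice_attained unfolding selections_def by auto
  qed
qed

text \<open>The weak axiom of revealed preference: by \<open>face_combine\<close> some point of the face has component
  \<open>e\<^sub>i\<close> in \<open>S\<close> and \<open>e\<^sub>j\<close> in \<open>S'\<close>. Swapping these two components is allowed by \<open>j \<in> S\<close> and
  \<open>i \<in> S'\<close>, and does not change the sum.\<close>

lemma face_choice_warp:
  assumes S: "S \<in> B" "S' \<in> B" and i: "i \<in> face_choice F S" "i \<in> S'"
    and j: "j \<in> face_choice F S'" "j \<in> S"
  shows "i \<in> face_choice F S'"
proof (cases "S = S'")
  case False
  obtain x where x: "x \<in> selections id" "(\<Sum>R\<in>B. x R) \<in> F" "x S = unit_vec i"
    using i by (auto simp: face_choice_def)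
  obtain y where y: "y \<in> selections id" "(\<Sum>R\<in>B. y R) \<in> F" "y S' = unit_vec j"
    using j by (auto simp: face_choice_def)
  let ?z = "x(S' := y S')" and ?z' = "x(S := unit_vec j, S' := unit_vec i)"
  have z: "(\<Sum>R\<in>B. ?z R) \<in> F" by (rule face_mix[OF x(1,2) y(1,2)])
  have "unit_vec j \<in> simplex_on S" "unit_vec i \<in> simplex_on S'"
    using i j by (auto intro: hull_inc)
  then have z': "?z' \<in> selections id" using x by (auto simp: selections_def)
  have split: "(\<Sum>R\<in>B. f R) = f S + (f S' + (\<Sum>R\<in>B - {S} - {S'}. f R))" for f :: "'a set \<Rightarrow> 'a \<Rightarrow>\<^sub>0 real"
    using sum.remove[of B S f] sum.remove[of "B - {S}" S' f] S finite_B False by auto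
  have "(\<Sum>R\<in>B. ?z' R) = (\<Sum>R\<in>B. ?z R)"
    unfolding split using False x(3) y(3) by (simp add: algebra_simps)
  then show ?thesis
    using z z' i unfolding face_choice_def by (intro CollectI conjI bexI[of _ ?z']) auto
qed (use assms in auto)

end

end

lemma maximisers_of_total_preorder:
  assumes V: "finite V"
    and total: "\<And>i j. i \<in> V \<Longrightarrow> j \<in> V \<Longrightarrow> R i j \<or> R j i"
    and trans: "\<And>i j k. \<lbrakk>i \<in> V; j \<in> V; k \<in> V; R i j; R j k\<rbrakk> \<Longrightarrow> R i k"
  obtains w :: "'a \<Rightarrow> nat" where "\<And>i j. i \<in> V \<Longrightarrow> j \<in> V \<Longrightarrow> w j \<le> w i \<longleftrightarrow> R i j"
proof
  let ?D = "\<lambda>i. {j\<in>V. R i j}"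
  fix i j assume ij: "i \<in> V" "j \<in> V"
  have fin: "finite (?D i)" for i using V by simp
  show "card (?D j) \<le> card (?D i) \<longleftrightarrow> R i j"
  proof
    assume le: "card (?D j) \<le> card (?D i)"
    show "R i j"
    proof (rule ccontr)
      assume n: "\<not> R i j"
      then have "?D i \<subset> ?D j" using ij total trans by blast
      then show False using psubset_card_mono[OF fin] le by (meson not_le)
    qed
  next
    assume "R i j"
    then have "?D j \<subseteq> ?D i" using ij trans by blast
    then show "card (?D j) \<le> card (?D i)" by (rule card_mono[OF fin])
  qed
qed

text \<open>A choice function on all sets between \<open>D\<close> and \<open>V\<close> that satisfies the weak axiom maximises a
  weight. The revealed preference compares \<open>i\<close> and \<open>j\<close> by the choice from the smallest admissible
  set \<open>D \<union> {i, j}\<close>. Elements that are not even chosen from \<open>D \<union> {i}\<close> are never chosen, and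
  they form a common bottom class. Transitivity comes from the choice out of a set
  \<open>D \<union> {i, j, k}\<close>.\<close>

lemma choice_rationalisable:
  fixes T :: "'a set \<Rightarrow> 'a set"
  assumes V: "finite V" and D: "D \<subseteq> V"
    and sub: "\<And>S. T S \<subseteq> S"
    and ne: "\<And>S. \<lbrakk>S \<subseteq> V; D \<subseteq> S; S \<noteq> {}\<rbrakk> \<Longrightarrow> T S \<noteq> {}"
    and warp: "\<And>S S' i j. \<lbrakk>S \<subseteq> V; D \<subseteq> S; S' \<subseteq> V; D \<subseteq> S'; i \<in> T S; i \<in> S'; j \<in> T S'; j \<in> S\<rbrakk>
      \<Longrightarrow> i \<in> T S'"
  obtains w :: "'a \<Rightarrow> nat" where "\<And>S. \<lbrakk>S \<subseteq> V; D \<subseteq> S; S \<noteq> {}\<rbrakk> \<Longrightarrow> T S = maximisers w S"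
proof -
  define ok where "ok i \<longleftrightarrow> i \<in> T (insert i D)" for i
  define R where "R i j \<longleftrightarrow> i \<in> T (insert i (insert j D)) \<or> (\<not> ok i \<and> \<not> ok j)" for i j
  have ok_chosen: "ok i" if "i \<in> T S" "S \<subseteq> V" "D \<subseteq> S" for i S
  proof -
    have "i \<in> V" using that sub by blast
    then obtain l where "l \<in> T (insert i D)" using ne[of "insert i D"] D by auto
    moreover have "l \<in> S" using calculation sub[of "insert i D"] sub[of S] that by auto
    ultimately show ?thesis unfolding ok_def
      using warp[of S "insert i D" i l] that \<open>i \<in> V\<close> D by auto
  qed
  have ok_beats: "i \<in> T S" if "ok i" "i \<in> S" "S \<subseteq> V" "D \<subseteq> S" "l \<in> T S" "l \<in> D" for i l S
    using warp[of "insert i D" S i l] that D unfolding ok_def by auto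
  have total: "R i j \<or> R j i" if ij: "i \<in> V" "j \<in> V" for i j
  proof -
    let ?S = "insert i (insert j D)"
    have S: "?S \<subseteq> V" "D \<subseteq> ?S" using ij D by auto
    obtain l where l: "l \<in> T ?S" using ne[OF S] by auto
    have "l = i \<or> l = j \<or> l \<in> D" using l sub[of ?S] by auto
    moreover have "?S = insert j (insert i D)" by auto
    ultimately show ?thesis
      using l ok_beats[OF _ _ S l, of i] ok_beats[OF _ _ S l, of j] unfolding R_def by auto
  qed
  have trans: "R i k" if ijk: "i \<in> V" "j \<in> V" "k \<in> V" and R: "R i j" "R j k" for i j k
  proof (cases "ok i")
    case False
    have "\<not> ok j"
      using R(1) False ok_chosen[of i "insert i (insert j D)"] ijk D unfolding R_def by auto
    then have "\<not> ok k"
      using R(2) ok_chosen[of j "insert j (insert k D)"] ijk D unfolding R_def by auto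
    with False show ?thesis by (simp add: R_def)
  next
    case True
    then have i: "i \<in> T (insert i (insert j D))" using R(1) by (auto simp: R_def)
    let ?S = "insert i (insert k D)"
    have S: "?S \<subseteq> V" "D \<subseteq> ?S" using ijk D by auto
    obtain l where l: "l \<in> T ?S" using ne[OF S] by auto
    have iS: "i \<in> T ?S"
    proof (cases "l = k \<and> k \<notin> D")
      case False
      then have "l = i \<or> l \<in> D" using l sub[of ?S] by auto
      then show ?thesis using l ok_beats[OF True _ S l] by auto
    next
      case kl: True
      then have "ok k" using ok_chosen[of k ?S] l S by auto
      then have j: "j \<in> T (insert j (insert k D))" using R(2) by (auto simp: R_def)
      let ?X = "insert i (insert j (insert k D))"
      have X: "?X \<subseteq> V" "D \<subseteq> ?X" using ijk D by auto
      obtain m where m: "m \<in> T ?X" using ne[OF X] by auto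
      have jX: "j \<in> T ?X" if "k \<in> T ?X"
        using warp[of "insert j (insert k D)" ?X j k] j that X ijk D by auto
      have iX: "i \<in> T ?X" if "j \<in> T ?X"
        using warp[of "insert i (insert j D)" ?X i j] i that X ijk D by auto
      have "m = i \<or> m = j \<or> m = k \<or> m \<in> D" using m sub[of ?X] by auto
      then have "i \<in> T ?X" using m iX jX ok_beats[OF True _ X m] by auto
      then show ?thesis using warp[of ?X ?S i k] l kl X S by auto
    qed
    then show ?thesis by (simp add: R_def)
  qed
  obtain w :: "'a \<Rightarrow> nat" where w: "\<And>i j. i \<in> V \<Longrightarrow> j \<in> V \<Longrightarrow> w j \<le> w i \<longleftrightarrow> R i j"
    by (rule maximisers_of_total_preorder[of V R]) (use V total trans in blast)+
  show thesis
  proof (rule that)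
    fix S assume S: "S \<subseteq> V" "D \<subseteq> S" "S \<noteq> {}"
    have "i \<in> T S \<longleftrightarrow> (\<forall>j\<in>S. R i j)" if i: "i \<in> S" for i
    proof
      assume iT: "i \<in> T S"
      show "\<forall>j\<in>S. R i j"
      proof
        fix j assume j: "j \<in> S"
        let ?Y = "insert i (insert j D)"
        have Y: "?Y \<subseteq> V" "D \<subseteq> ?Y" using i j S by auto
        obtain l where l: "l \<in> T ?Y" using ne[OF Y] by auto
        then have "l \<in> S" using sub[of ?Y] i j S by auto
        then show "R i j" using warp[of S ?Y i l] iT l S Y by (auto simp: R_def)
      qed
    next
      assume all: "\<forall>j\<in>S. R i j"
      obtain k where k: "k \<in> T S" using ne S by blast
      then have kS: "k \<in> S" using sub by blast
      have "ok k" using ok_chosen k S by blast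
      then have "i \<in> T (insert i (insert k D))" using all kS by (auto simp: R_def)
      then show "i \<in> T S" using warp[of "insert i (insert k D)" S i k] k kS i S by auto
    qed
    then show "T S = maximisers w S"
      using w S sub[of S] unfolding maximisers_def by blast
  qed
qed

section \<open>Dimensions of faces\<close>

lemma simplex_minus_vertex_in_span:
  assumes T: "finite T" "k \<in> T" and x: "x \<in> simplex_on T"
  shows "x - unit_vec k \<in> span {unit_vec i - unit_vec j | i j. i \<in> T \<and> j \<in> T}"
proof -
  let ?l = "Poly_Mapping.lookup x"
  have l: "\<And>i. i \<notin> T \<Longrightarrow> ?l i = 0" "(\<Sum>i\<in>T. ?l i) = 1"
    using x T(1) by (auto simp: simplex_on_iff)
  have "x - unit_vec k = (\<Sum>i\<in>T. ?l i *\<^sub>R unit_vec i) - (\<Sum>i\<in>T. ?l i) *\<^sub>R unit_vec k"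
    using unit_vec_expansion[OF T(1) l(1)] l(2) by simp
  also have "\<dots> = (\<Sum>i\<in>T. ?l i *\<^sub>R (unit_vec i - unit_vec k))"
    by (simp add: scaleR_diff_right sum_subtractf scaleR_sum_left)
  also have "\<dots> \<in> span {unit_vec i - unit_vec j | i j. i \<in> T \<and> j \<in> T}"
    using T(2) by (intro span_sum span_scale span_base) auto
  finally show ?thesis .
qed

text \<open>The differences \<open>e\<^sub>i - e\<^sub>r\<close>, where \<open>r\<close> is a chosen representative of the class of \<open>i\<close> and
  \<open>i\<close> is not itself a representative, form a basis: the vector \<open>e\<^sub>i - e\<^sub>r\<close> is the only one of them
  with a nonzero coordinate at \<open>i\<close>.\<close>

lemma dim_class_differences:
  fixes c :: "'a \<Rightarrow> 'b"
  assumes V: "finite V"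
  shows "dim {unit_vec i - unit_vec j | i j. i \<in> V \<and> j \<in> V \<and> c i = c j} = card V - card (c ` V)"
    (is "dim ?D = _")
proof -
  define rep where "rep i = inv_into V c (c i)" for i
  have rep: "rep i \<in> V" "c (rep i) = c i" if "i \<in> V" for i
    using that by (auto simp: rep_def inv_into_into f_inv_into_f)
  have rep_cong: "rep i = rep j" if "c i = c j" for i j
    using that by (simp add: rep_def)
  define W where "W = V - rep ` V"
  have W: "finite W" "W \<subseteq> V" using V by (auto simp: W_def)
  let ?b = "\<lambda>i. unit_vec i - unit_vec (rep i)"
  have lookup_b: "Poly_Mapping.lookup (?b i) j = (if i = j then 1 else 0)" if "i \<in> W" "j \<in> W" for i j
    using that by (auto simp: lookup_minus lookup_unit_vec W_def)
  have inj: "inj_on ?b W"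
    using lookup_b by (intro inj_onI) (metis zero_neq_one)
  have "span (?b ` W) = span ?D"
  proof (rule span_eq[THEN iffD2, OF conjI])
    show "?b ` W \<subseteq> span ?D"
      using W rep by (auto intro!: span_base) (metis subsetD)
    show "?D \<subseteq> span (?b ` W)"
    proof clarify
      fix i j assume ij: "i \<in> V" "j \<in> V" "c i = c j"
      have b: "?b k \<in> span (?b ` W)" if k: "k \<in> V" for k
      proof (cases "k \<in> W")
        case False
        then obtain l where "l \<in> V" "k = rep l" using k unfolding W_def by blast
        then have "rep k = k" using rep rep_cong by metis
        then show ?thesis by (simp add: span_zero)
      qed (auto intro: span_base)
      have "unit_vec i - unit_vec j = ?b i - ?b j"
        using rep_cong[OF ij(3)] by simp
      then show "unit_vec i - unit_vec j \<in> span (?b ` W)"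
        using span_diff[OF b[OF ij(1)] b[OF ij(2)]] by metis
    qed
  qed
  moreover have "independent (?b ` W)"
  proof (rule independent_if_scalars_zero)
    fix f x assume s: "(\<Sum>x\<in>?b ` W. f x *\<^sub>R x) = 0" and "x \<in> ?b ` W"
    then obtain i where i: "i \<in> W" "x = ?b i" by auto
    have "0 = Poly_Mapping.lookup (\<Sum>j\<in>W. f (?b j) *\<^sub>R ?b j) i"
      using s by (simp add: sum.reindex[OF inj])
    also have "\<dots> = (\<Sum>j\<in>W. if j = i then f (?b j) else 0)"
      unfolding lookup_sum lookup_scaleR using lookup_b i by (intro sum.cong) auto
    also have "\<dots> = f x" using W i by simp
    finally show "f x = 0" by simp
  qed (use W in auto)
  ultimately have "dim ?D = card (?b ` W)" by (rule dim_eq_card)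
  also have "\<dots> = card V - card (rep ` V)"
    using card_image[OF inj] card_Diff_subset[of "rep ` V" V] V rep(1) by (auto simp: W_def)
  also have "card (rep ` V) = card (c ` V)"
  proof -
    have "rep ` V = inv_into V c ` c ` V" by (simp add: rep_def image_image)
    then show ?thesis by (simp add: card_image inj_on_inv_into)
  qed
  finally show ?thesis .
qed

context simplex_sum
begin

lemma span_differences:
  assumes T: "\<And>S. S \<in> B \<Longrightarrow> T S \<noteq> {}" "\<And>S. S \<in> B \<Longrightarrow> T S \<subseteq> S"
  shows "span {x - y | x y. x \<in> sum_polytope T \<and> y \<in> sum_polytope T} =
    span {unit_vec i - unit_vec j | i j. \<exists>S\<in>B. i \<in> T S \<and> j \<in> T S}" (is "span ?P = span ?E")
proof (rule span_eq[THEN iffD2, OF conjI])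
  show "?P \<subseteq> span ?E"
  proof clarify
    fix x y assume "x \<in> sum_polytope T" "y \<in> sum_polytope T"
    then obtain z z' where z: "z \<in> selections T" "z' \<in> selections T"
      and xy: "x = (\<Sum>S\<in>B. z S)" "y = (\<Sum>S\<in>B. z' S)"
      by (auto simp: sum_polytope_eq)
    have "z S - z' S \<in> span ?E" if S: "S \<in> B" for S
    proof -
      obtain k where k: "k \<in> T S" using T(1) S by auto
      have fT: "finite (T S)" using T(2) S finite_member finite_subset by metis
      have sub: "span {unit_vec i - unit_vec j | i j. i \<in> T S \<and> j \<in> T S} \<subseteq> span ?E"
        using S by (intro span_mono) auto
      have "z S \<in> simplex_on (T S)" "z' S \<in> simplex_on (T S)"
        using z S unfolding selections_def by auto
      then have "z S - unit_vec k \<in> span ?E" "z' S - unit_vec k \<in> span ?E"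
        using simplex_minus_vertex_in_span[OF fT k] sub by blast+
      then have "(z S - unit_vec k) - (z' S - unit_vec k) \<in> span ?E" by (rule span_diff)
      then show ?thesis by simp
    qed
    then have "(\<Sum>S\<in>B. z S - z' S) \<in> span ?E" by (rule span_sum)
    then show "x - y \<in> span ?E" by (simp add: xy sum_subtractf)
  qed
  show "?E \<subseteq> span ?P"
  proof clarify
    fix i j S assume S: "S \<in> B" and ij: "i \<in> T S" "j \<in> T S"
    obtain z where z: "z \<in> selections T" "z S = unit_vec i"
      using vertex_selection_exists[of T S i] T S ij by blast
    let ?z = "z(S := unit_vec j)"
    have "unit_vec j \<in> simplex_on (T S)" using ij by (intro hull_inc) auto
    then have z': "?z \<in> selections T" using z(1) by (auto simp: selections_def)
    have "(\<Sum>R\<in>B. z R) - (\<Sum>R\<in>B. ?z R) = (\<Sum>R\<in>B. z R - ?z R)"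
      by (simp only: sum_subtractf)
    also have "\<dots> = (\<Sum>R\<in>B. if R = S then unit_vec i - unit_vec j else 0)"
      using z(2) by (intro sum.cong) auto
    also have "\<dots> = unit_vec i - unit_vec j"
      using S finite_B by simp
    finally have "unit_vec i - unit_vec j = (\<Sum>R\<in>B. z R) - (\<Sum>R\<in>B. ?z R)" ..
    then show "unit_vec i - unit_vec j \<in> span ?P"
      using z(1) z' unfolding sum_polytope_eq by (intro span_base) blast
  qed
qed

lemma convex_dim_weight_face:
  assumes "\<And>i j. (\<exists>S\<in>B. i \<in> maximisers w S \<and> j \<in> maximisers w S) \<longleftrightarrow> i \<in> V \<and> j \<in> V \<and> c i = c j"
  shows "convex_dim (sum_polytope (maximisers w)) = card V - card (c ` V)"
proof -
  have "convex_dim (sum_polytope (maximisers w)) =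
      dim (span {x - y | x y. x \<in> sum_polytope (maximisers w) \<and> y \<in> sum_polytope (maximisers w)})"
    by (simp add: convex_dim_def dim_span)
  also have "\<dots> = dim {unit_vec i - unit_vec j | i j. i \<in> V \<and> j \<in> V \<and> c i = c j}"
    using span_differences[of "maximisers w", OF maximisers_nonempty[OF finite_member B_nonempty] maximisers_subset]
    by (simp add: assms dim_span)
  finally show ?thesis by (simp add: dim_class_differences[OF finite_V])
qed

end

section \<open>Canonical weights\<close>

lemma rank_strict_mono:
  fixes A :: "nat set"
  assumes "finite A" "a < b" "b \<in> A"
  shows "card {v\<in>A. v \<le> a} < card {v\<in>A. v \<le> b}"
proof (rule psubset_card_mono)
  have "b \<in> {v\<in>A. v \<le> b} - {v\<in>A. v \<le> a}" "{v\<in>A. v \<le> a} \<subseteq> {v\<in>A. v \<le> b}"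
    using assms by auto
  then show "{v\<in>A. v \<le> a} \<subset> {v\<in>A. v \<le> b}" by blast
qed (use assms in simp)

lemma rank_image:
  fixes A :: "nat set"
  assumes "finite A"
  shows "(\<lambda>a. card {v\<in>A. v \<le> a}) ` A = {1..card A}"
proof (rule card_subset_eq)
  let ?f = "\<lambda>a. card {v\<in>A. v \<le> a}"
  have "1 \<le> ?f a" if "a \<in> A" for a
    using that assms by (simp add: Suc_le_eq card_gt_0_iff) auto
  moreover have "?f a \<le> card A" for a using assms by (intro card_mono) auto
  ultimately show "?f ` A \<subseteq> {1..card A}" by auto
  have lt: "?f a < ?f b" if "a < b" "b \<in> A" for a b
    by (rule rank_strict_mono[OF assms that])
  have "inj_on ?f A"
  proof (rule inj_onI)
    fix a b assume ab: "a \<in> A" "b \<in> A" "?f a = ?f b"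
    show "a = b"
      by (rule linorder_cases[of a b]) (use lt[of a b] lt[of b a] ab in simp_all)
  qed
  then show "card (?f ` A) = card {1..card A}" by (simp add: card_image)
qed simp

lemma card_image_eq_if_same_kernel:
  assumes "\<And>x y. \<lbrakk>x \<in> J; y \<in> J\<rbrakk> \<Longrightarrow> f x = f y \<longleftrightarrow> g x = g y"
  shows "card (f ` J) = card (g ` J)"
proof -
  have "bij_betw (\<lambda>v. g (inv_into J f v)) (f ` J) (g ` J)"
    unfolding bij_betw_def
  proof
    show "inj_on (\<lambda>v. g (inv_into J f v)) (f ` J)"
    proof (rule inj_onI)
      fix v v' assume v: "v \<in> f ` J" "v' \<in> f ` J" "g (inv_into J f v) = g (inv_into J f v')"
      then have "f (inv_into J f v) = f (inv_into J f v')"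
        using assms inv_into_into by metis
      then show "v = v'" using v by (simp add: f_inv_into_f)
    qed
    have "g (inv_into J f (f x)) = g x" if "x \<in> J" for x
      using assms[of "inv_into J f (f x)" x] that by (auto simp: inv_into_into f_inv_into_f)
    then show "(\<lambda>v. g (inv_into J f v)) ` f ` J = g ` J"
      by (simp add: image_image)
  qed
  then show ?thesis by (rule bij_betw_same_card)
qed

text \<open>The building set of the complete graph on \<open>V\<close> is \<open>cones V {}\<close>, and that of the star with centre \<open>c\<close> is
  \<open>cones V {c}\<close>.\<close>

definition cones :: "'a set \<Rightarrow> 'a set \<Rightarrow> 'a set set"
  where "cones V D = {S. S \<noteq> {} \<and> S \<subseteq> V \<and> (D \<subseteq> S \<or> (\<exists>i. S = {i}))}"

text \<open>The value 0 marks elements that weigh less than the centre. Such an element is chosen only from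
  its singleton, hence all of them may share one value. Extensionality makes the representative
  of a face unique as a function on the whole type.\<close>

definition canonical_weights :: "'a set \<Rightarrow> 'a set \<Rightarrow> ('a \<Rightarrow> nat) set"
  where "canonical_weights V D = {r \<in> extensional V.
    (\<exists>K. r ` V - {0} = {1..K}) \<and> (D = {} \<longrightarrow> 0 \<notin> r ` V) \<and> (\<forall>d\<in>D. r d = 1)}"

text \<open>The number of classes of elements that a weight identifies, where every element of weight 0 is
  a class of its own.\<close>

definition weight_codim :: "'a set \<Rightarrow> ('a \<Rightarrow> nat) \<Rightarrow> nat"
  where "weight_codim V r = card (r ` V - {0}) + card {i\<in>V. r i = 0}"

locale cone_building =
  fixes V D :: "'a set"
  assumes fin_V: "finite V" and V_nonempty: "V \<noteq> {}" and D_subset: "D \<subseteq> V"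
    and D_unique: "\<lbrakk>d \<in> D; d' \<in> D\<rbrakk> \<Longrightarrow> d = d'"
begin

sublocale simplex_sum V "cones V D"
  by unfold_locales (auto simp: fin_V cones_def)

lemma insert_D_cone: "i \<in> V \<Longrightarrow> j \<in> V \<Longrightarrow> insert i (insert j D) \<in> cones V D"
  using D_subset by (auto simp: cones_def)

lemma D_cases: obtains "D = {}" | c where "D = {c}" "c \<in> V"
  using D_unique D_subset by blast

lemma sum_polytope_cong:
  "(\<And>S. S \<in> cones V D \<Longrightarrow> T S = T' S) \<Longrightarrow> sum_polytope T = sum_polytope T'"
  unfolding sum_polytope_def by (rule sum.cong) auto

lemma face_is_weight_face:
  assumes F: "F face_of sum_polytope id" "F \<noteq> {}"
  obtains w where "F = sum_polytope (maximisers w)"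
proof -
  have cone: "S \<in> cones V D" if "S \<subseteq> V" "D \<subseteq> S" "S \<noteq> {}" for S
    using that by (simp add: cones_def)
  obtain w where w: "\<And>S. \<lbrakk>S \<subseteq> V; D \<subseteq> S; S \<noteq> {}\<rbrakk> \<Longrightarrow> face_choice F S = maximisers w S"
  proof (rule choice_rationalisable[of V D "face_choice F"])
    fix S S' i j
    assume "S \<subseteq> V" "D \<subseteq> S" "S' \<subseteq> V" "D \<subseteq> S'" "i \<in> face_choice F S" "i \<in> S'"
      "j \<in> face_choice F S'" "j \<in> S"
    then show "i \<in> face_choice F S'"
      using face_choice_warp[OF F(1), of S S' i j] cone by blast
  qed (use fin_V D_subset face_choice_subset face_choice_nonempty[OF F] cone in blast)+
  have "face_choice F S = maximisers w S" if S: "S \<in> cones V D" for S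
  proof (cases "D \<subseteq> S")
    case True
    then show ?thesis using w S by (auto simp: cones_def)
  next
    case False
    then obtain i where "S = {i}" using S by (auto simp: cones_def)
    then show ?thesis
      using face_choice_nonempty[OF F S] face_choice_subset[of F S]
      by (auto simp: maximisers_def)
  qed
  then have "F = sum_polytope (maximisers w)"
    using face_eq_sum_choice[OF F] sum_polytope_cong by metis
  then show thesis by (rule that)
qed

text \<open>A weight is replaced by its rank among the values that are at least the value \<open>b\<close> of the
  centre. Values below \<open>b\<close> then automatically get rank 0 and \<open>b\<close> itself gets rank 1.\<close>

lemma canonical_exists:
  obtains r where "r \<in> canonical_weights V D" "\<And>S. S \<in> cones V D \<Longrightarrow> maximisers r S = maximisers w S"
proof -
  define b where "b = (if D = {} then 0 else w (the_elem D))"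
  have wD: "w d = b" if "d \<in> D" for d
    using that by (cases rule: D_cases) (auto simp: b_def)
  define A where "A = {v \<in> w ` V. b \<le> v}"
  have fA: "finite A" using fin_V by (simp add: A_def)
  define \<rho> where "\<rho> a = card {v\<in>A. v \<le> a}" for a
  define r where "r = restrict (\<lambda>i. \<rho> (w i)) V"
  have r: "r i = \<rho> (w i)" if "i \<in> V" for i using that by (simp add: r_def)
  have mono: "\<rho> x \<le> \<rho> y" if "x \<le> y" for x y
    unfolding \<rho>_def using fA that by (intro card_mono) auto
  have strict: "\<rho> x < \<rho> y" if "x < y" "y \<in> A" for x y
    unfolding \<rho>_def by (rule rank_strict_mono[OF fA that])
  have zero: "\<rho> (w i) = 0 \<longleftrightarrow> w i < b" if "i \<in> V" for i
  proof
    show "w i < b \<Longrightarrow> \<rho> (w i) = 0" by (auto simp: \<rho>_def A_def)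
    assume "\<rho> (w i) = 0"
    then have "{v\<in>A. v \<le> w i} = {}" using fA by (simp add: \<rho>_def)
    then have "w i \<notin> A" by blast
    then show "w i < b" using that by (simp add: A_def)
  qed
  have "r ` V - {0} = \<rho> ` A"
  proof
    show "r ` V - {0} \<subseteq> \<rho> ` A"
    proof
      fix v assume "v \<in> r ` V - {0}"
      then obtain i where i: "i \<in> V" "v = r i" "r i \<noteq> 0" by blast
      then have "w i \<in> A" using zero[of i] by (simp add: A_def r)
      then show "v \<in> \<rho> ` A" using r[OF i(1)] i(2) by simp
    qed
    show "\<rho> ` A \<subseteq> r ` V - {0}"
    proof (rule image_subsetI)
      fix v assume "v \<in> A"
      then obtain i where "i \<in> V" "v = w i" "b \<le> w i" by (auto simp: A_def)
      then show "\<rho> v \<in> r ` V - {0}" using r[of i] zero[of i] by force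
    qed
  qed
  moreover have "\<rho> ` A = {1..card A}" unfolding \<rho>_def by (rule rank_image[OF fA])
  moreover have "0 \<notin> r ` V" if "D = {}"
  proof
    assume "0 \<in> r ` V"
    then obtain i where "i \<in> V" "r i = 0" by force
    then show False using r[of i] zero[of i] that by (simp add: b_def)
  qed
  moreover have "r d = 1" if d: "d \<in> D" for d
  proof -
    have "d \<in> V" using d D_subset by auto
    then have "b \<in> w ` V" using wD[OF d] by force
    then have "{v\<in>A. v \<le> b} = {b}" by (auto simp: A_def)
    then show ?thesis using r[OF \<open>d \<in> V\<close>] wD[OF d] by (simp add: \<rho>_def)
  qed
  ultimately have "r \<in> canonical_weights V D"
    by (auto simp: canonical_weights_def r_def)
  moreover have "maximisers r S = maximisers w S" if S: "S \<in> cones V D" for S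
  proof (cases "D \<subseteq> S")
    case True
    have SV: "S \<subseteq> V" using S by (simp add: cones_def)
    have "i \<in> maximisers w S" if i: "i \<in> maximisers r S" for i
    proof -
      have iS: "i \<in> S" and max: "\<And>j. j \<in> S \<Longrightarrow> \<rho> (w j) \<le> \<rho> (w i)"
        using i r SV by (auto simp: maximisers_def subset_iff)
      have "b \<le> w i"
      proof (cases rule: D_cases)
        case (2 c)
        then have "c \<in> S" using True by auto
        then show ?thesis using max[of c] zero[of c] zero[of i] wD[of c] 2 iS SV by fastforce
      qed (simp add: b_def)
      have "w j \<le> w i" if j: "j \<in> S" for j
      proof (rule ccontr)
        assume "\<not> w j \<le> w i"
        then have "w i < w j" by simp
        moreover have "w j \<in> A" using calculation \<open>b \<le> w i\<close> j SV by (auto simp: A_def)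
        ultimately show False using strict[of "w i" "w j"] max[OF j] by simp
      qed
      then show ?thesis using iS by (simp add: maximisers_def)
    qed
    moreover have "i \<in> maximisers r S" if "i \<in> maximisers w S" for i
      using that r SV mono by (auto simp: maximisers_def subset_iff)
    ultimately show ?thesis by blast
  next
    case False
    then obtain i where "S = {i}" using S by (auto simp: cones_def)
    then show ?thesis by (auto simp: maximisers_def)
  qed
  ultimately show thesis by (rule that)
qed

context
  fixes r assumes r: "r \<in> canonical_weights V D"
begin

lemma canonical_D: "d \<in> D \<Longrightarrow> r d = 1"
  using r by (auto simp: canonical_weights_def)

lemma canonical_zero_iff: "i \<in> V \<Longrightarrow> r i = 0 \<longleftrightarrow> i \<notin> maximisers r (insert i D)"
  using r by (cases rule: D_cases) (force simp: canonical_weights_def maximisers_def)+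

lemma canonical_le_iff:
  "\<lbrakk>i \<in> V; j \<in> V; r j \<noteq> 0\<rbrakk> \<Longrightarrow> r i \<le> r j \<longleftrightarrow> j \<in> maximisers r (insert i (insert j D))"
  by (auto simp: maximisers_def canonical_D)

text \<open>The weight of \<open>i\<close> is recovered by counting the positive values up to it, since these have no
  gaps. Together with the order this determines a canonical weight.\<close>

lemma canonical_value:
  assumes "i \<in> V" "r i \<noteq> 0"
  shows "r i = card (r ` {j\<in>V. r j \<noteq> 0 \<and> r j \<le> r i})"
proof -
  obtain K where K: "r ` V - {0} = {1..K}" using r by (auto simp: canonical_weights_def)
  have "r ` {j\<in>V. r j \<noteq> 0 \<and> r j \<le> r i} = {v \<in> r ` V - {0}. v \<le> r i}" by auto
  moreover have "r i \<in> r ` V - {0}" using assms by simp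
  ultimately have "r ` {j\<in>V. r j \<noteq> 0 \<and> r j \<le> r i} = {1..r i}" unfolding K by auto
  then show ?thesis by simp
qed

text \<open>The centre has weight 1, thus it does not prevent two elements of equal positive weight from being
  chosen together, whereas it beats every element of weight 0.\<close>

lemma canonical_class:
  "(\<exists>S\<in>cones V D. i \<in> maximisers r S \<and> j \<in> maximisers r S) \<longleftrightarrow>
    i \<in> V \<and> j \<in> V \<and> (if r i = 0 then Inr i else Inl (r i)) = (if r j = 0 then Inr j else Inl (r j))"
proof
  assume "\<exists>S\<in>cones V D. i \<in> maximisers r S \<and> j \<in> maximisers r S"
  then obtain S where S: "S \<in> cones V D" and ij: "i \<in> maximisers r S" "j \<in> maximisers r S" by blast
  have V: "i \<in> V" "j \<in> V" using S ij by (auto simp: cones_def maximisers_def)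
  have eq: "r i = r j" using ij by (auto simp: maximisers_def intro: antisym)
  moreover have "i = j" if "r i = 0"
  proof (cases "D \<subseteq> S")
    case True
    then have "i \<in> maximisers r (insert i D)" using ij by (auto simp: maximisers_def)
    then show ?thesis using canonical_zero_iff V that by blast
  next
    case False
    then show ?thesis using S ij by (auto simp: cones_def maximisers_def)
  qed
  ultimately show "i \<in> V \<and> j \<in> V \<and>
    (if r i = 0 then Inr i else Inl (r i)) = (if r j = 0 then Inr j else Inl (r j))"
    using V by auto
next
  assume *: "i \<in> V \<and> j \<in> V \<and>
    (if r i = 0 then Inr i else Inl (r i)) = (if r j = 0 then Inr j else Inl (r j))"
  show "\<exists>S\<in>cones V D. i \<in> maximisers r S \<and> j \<in> maximisers r S"
  proof (cases "r i = 0")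
    case True
    then have "i = j" using * by (auto split: if_splits)
    then show ?thesis using * by (intro bexI[of _ "{i}"]) (auto simp: cones_def maximisers_def)
  next
    case False
    then have "r i = r j" using * by (auto split: if_splits)
    then have "i \<in> maximisers r (insert i (insert j D))" "j \<in> maximisers r (insert i (insert j D))"
      using * False by (auto simp: maximisers_def canonical_D)
    then show ?thesis using insert_D_cone * by blast
  qed
qed

lemma convex_dim_canonical:
  "convex_dim (sum_polytope (maximisers r)) = card V - weight_codim V r"
proof -
  let ?c = "\<lambda>i. if r i = 0 then Inr i else Inl (r i)"
  have "?c ` V = Inl ` (r ` V - {0}) \<union> Inr ` {i\<in>V. r i = 0}"
    by (auto simp: image_iff)
  then have "card (?c ` V) = card (Inl ` (r ` V - {0}) :: (nat + 'a) set) + card (Inr ` {i\<in>V. r i = 0} :: (nat + 'a) set)"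
    using fin_V by (simp only:) (intro card_Un_disjoint, auto)
  also have "\<dots> = weight_codim V r" by (simp add: weight_codim_def card_image)
  finally show ?thesis using convex_dim_weight_face[of r ?c, OF canonical_class] by simp
qed

end

lemma canonical_unique:
  assumes r: "r \<in> canonical_weights V D" and r': "r' \<in> canonical_weights V D"
    and eq: "\<And>S. S \<in> cones V D \<Longrightarrow> maximisers r S = maximisers r' S"
  shows "r = r'"
proof (rule extensionalityI[of _ V])
  fix i assume i: "i \<in> V"
  have zero: "r j = 0 \<longleftrightarrow> r' j = 0" if "j \<in> V" for j
    using canonical_zero_iff[OF r that] canonical_zero_iff[OF r' that]
      eq[of "insert j D"] insert_D_cone[OF that that] by simp
  have le: "r j \<le> r k \<longleftrightarrow> r' j \<le> r' k" if "j \<in> V" "k \<in> V" "r k \<noteq> 0" for j k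
    using canonical_le_iff[OF r, of j k] canonical_le_iff[OF r', of j k] zero that
      eq[OF insert_D_cone] by simp
  show "r i = r' i"
  proof (cases "r i = 0")
    case True
    then show ?thesis using zero[OF i] by simp
  next
    case False
    let ?J = "{j\<in>V. r j \<noteq> 0 \<and> r j \<le> r i}"
    have J: "?J = {j\<in>V. r' j \<noteq> 0 \<and> r' j \<le> r' i}"
      using zero le[OF _ i False] by (intro Collect_cong) (metis (no_types, lifting))
    have "r i = card (r ` ?J)" using canonical_value[OF r i False] .
    also have "\<dots> = card (r' ` ?J)"
    proof (rule card_image_eq_if_same_kernel)
      fix x y assume "x \<in> ?J" "y \<in> ?J"
      then show "r x = r y \<longleftrightarrow> r' x = r' y" using le[of x y] le[of y x] by (auto intro: antisym)
    qed
    also have "\<dots> = r' i" using canonical_value[OF r' i] zero[OF i] False unfolding J by simp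
    finally show ?thesis .
  qed
qed (use r r' in \<open>auto simp: canonical_weights_def\<close>)

lemma finite_canonical: "finite (canonical_weights V D)"
proof (rule finite_subset)
  show "canonical_weights V D \<subseteq> V \<rightarrow>\<^sub>E {0..card V}"
  proof
    fix r assume "r \<in> canonical_weights V D"
    then obtain K where K: "r ` V - {0} = {1..K}" and e: "r \<in> extensional V"
      by (auto simp: canonical_weights_def)
    have "K = card (r ` V - {0})" by (simp add: K)
    also have "\<dots> \<le> card (r ` V)" using fin_V by (intro card_mono) auto
    also have "\<dots> \<le> card V" by (rule card_image_le[OF fin_V])
    finally have "K \<le> card V" .
    then have "r i \<le> card V" if "i \<in> V" for i
    proof (cases "r i = 0")
      case False
      then have "r i \<in> r ` V - {0}" using that by simp
      then have "r i \<in> {1..K}" unfolding K .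
      then show ?thesis using \<open>K \<le> card V\<close> by simp
    qed simp
    then show "r \<in> V \<rightarrow>\<^sub>E {0..card V}" using e by (auto simp: PiE_def)
  qed
qed (use fin_V in \<open>auto intro: finite_PiE\<close>)

lemma weight_codim_pos: "weight_codim V r \<ge> 1"
proof -
  obtain i where "i \<in> V" using V_nonempty by auto
  then have "r ` V - {0} \<noteq> {} \<or> {i\<in>V. r i = 0} \<noteq> {}" by (cases "r i = 0") auto
  moreover have "finite (r ` V - {0})" "finite {i\<in>V. r i = 0}" using fin_V by auto
  ultimately have "card (r ` V - {0}) \<noteq> 0 \<or> card {i\<in>V. r i = 0} \<noteq> 0"
    by (metis card_0_eq)
  then show ?thesis by (auto simp: weight_codim_def)
qed

lemma bij_betw_faces:
  "bij_betw (\<lambda>r. sum_polytope (maximisers r)) (canonical_weights V D)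
    {F. F face_of sum_polytope id \<and> F \<noteq> {}}"
  unfolding bij_betw_def
proof
  show "inj_on (\<lambda>r. sum_polytope (maximisers r)) (canonical_weights V D)"
    using canonical_unique weight_face_eqD by (intro inj_onI) metis
  have ne: "sum_polytope (maximisers r) \<noteq> {}" for r
  proof -
    have "(\<lambda>S. unit_vec (SOME j. j \<in> maximisers r S)) \<in> selections (maximisers r)"
      unfolding selections_def
    proof (intro CollectI ballI hull_inc imageI)
      fix S assume "S \<in> cones V D"
      then show "(SOME j. j \<in> maximisers r S) \<in> maximisers r S"
        using maximisers_nonempty finite_member B_nonempty by (metis some_in_eq)
    qed
    then show ?thesis unfolding sum_polytope_eq by blast
  qed
  show "(\<lambda>r. sum_polytope (maximisers r)) ` canonical_weights V D =
      {F. F face_of sum_polytope id \<and> F \<noteq> {}}"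
  proof
    show "{F. F face_of sum_polytope id \<and> F \<noteq> {}} \<subseteq>
        (\<lambda>r. sum_polytope (maximisers r)) ` canonical_weights V D"
    proof clarify
      fix F assume "F face_of sum_polytope id" "F \<noteq> {}"
      then obtain w where w: "F = sum_polytope (maximisers w)" by (rule face_is_weight_face)
      obtain r where "r \<in> canonical_weights V D"
        "\<And>S. S \<in> cones V D \<Longrightarrow> maximisers r S = maximisers w S"
        by (rule canonical_exists[of w]) blast
      then show "F \<in> (\<lambda>r. sum_polytope (maximisers r)) ` canonical_weights V D"
        using w sum_polytope_cong by (metis image_eqI)
    qed
  qed (use weight_face_face_of ne in auto)
qed

lemma convex_dim_polytope: "convex_dim (sum_polytope id) = card V - 1"
proof -
  let ?r = "restrict (\<lambda>_. 1) V :: 'a \<Rightarrow> nat"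
  have im: "?r ` V = {1}" using V_nonempty by auto
  have "?r \<in> canonical_weights V D"
    unfolding canonical_weights_def mem_Collect_eq im using D_subset
    by (intro conjI exI[of _ 1]) auto
  then have "convex_dim (sum_polytope (maximisers ?r)) = card V - weight_codim V ?r"
    by (rule convex_dim_canonical)
  moreover have "weight_codim V ?r = 1" unfolding weight_codim_def im by simp
  moreover have "sum_polytope (maximisers ?r) = sum_polytope id"
  proof (rule sum_polytope_cong)
    fix S assume "S \<in> cones V D"
    then have "S \<subseteq> V" by (simp add: cones_def)
    then show "maximisers ?r S = id S" by (auto simp: maximisers_def subset_iff)
  qed
  ultimately show ?thesis by simp
qed

lemma F_poly_eq:
  "F_poly (sum_polytope id) = (\<Sum>r\<in>canonical_weights V D.
    var_alpha ^ (card V - weight_codim V r) * var_t ^ (weight_codim V r - 1))"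
proof -
  let ?C = "canonical_weights V D" and ?d = "\<lambda>r. card V - weight_codim V r"
  let ?n = "card V - 1"
  have le: "?d r \<le> ?n" for r using weight_codim_pos[of r] by simp
  have codim_le: "weight_codim V r \<le> card V" for r
  proof -
    have "card (r ` V - {0}) \<le> card (r ` {i\<in>V. r i \<noteq> 0})"
      using fin_V by (intro card_mono) auto
    also have "\<dots> \<le> card {i\<in>V. r i \<noteq> 0}" using fin_V by (intro card_image_le) auto
    finally have "weight_codim V r \<le> card {i\<in>V. r i \<noteq> 0} + card {i\<in>V. r i = 0}"
      by (simp add: weight_codim_def)
    also have "\<dots> = card ({i\<in>V. r i \<noteq> 0} \<union> {i\<in>V. r i = 0})"
      using fin_V by (intro card_Un_disjoint[symmetric]) auto
    also have "{i\<in>V. r i \<noteq> 0} \<union> {i\<in>V. r i = 0} = V" by auto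
    finally show ?thesis .
  qed
  have fn: "face_number (sum_polytope id) i = card {r\<in>?C. ?d r = i}" for i
  proof -
    have "bij_betw (\<lambda>r. sum_polytope (maximisers r)) {r\<in>?C. ?d r = i}
        {F \<in> {F. F face_of sum_polytope id \<and> F \<noteq> {}}. convex_dim F = i}"
      by (rule bij_betw_Collect[OF bij_betw_faces]) (simp add: convex_dim_canonical)
    then show ?thesis unfolding face_number_def
      by (simp add: bij_betw_same_card conj_assoc)
  qed
  have "F_poly (sum_polytope id) =
      (\<Sum>i\<le>?n. \<Sum>r\<in>{r\<in>?C. ?d r = i}. var_alpha ^ i * var_t ^ (?n - i))"
    by (simp add: F_poly_def convex_dim_polytope fn mult.assoc)
  also have "\<dots> = (\<Sum>i\<le>?n. \<Sum>r\<in>{r\<in>?C. ?d r = i}. var_alpha ^ ?d r * var_t ^ (weight_codim V r - 1))"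
  proof (intro sum.cong refl)
    fix i r assume "r \<in> {r\<in>?C. ?d r = i}"
    then show "var_alpha ^ i * var_t ^ (?n - i) = var_alpha ^ ?d r * var_t ^ (weight_codim V r - 1)"
      using codim_le[of r] by auto
  qed
  also have "\<dots> = (\<Sum>r\<in>?C. var_alpha ^ ?d r * var_t ^ (weight_codim V r - 1))"
    using finite_canonical le by (intro sum.group) auto
  finally show ?thesis .
qed

end

section \<open>Counting canonical weights\<close>

text \<open>Inclusion and exclusion over the values in \<open>C\<close>, which have to be attained: the functions that
  attain \<open>c\<close> are all functions without those that avoid \<open>c\<close>. Every value of \<open>E\<close> that is merely
  admitted contributes a factor \<open>X\<close> to the exponential generating function, so every value that
  is required contributes \<open>X - 1\<close>. The values in \<open>B0\<close> are admitted throughout, and their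
  contribution is contained in \<open>\<kappa>\<close>.\<close>

lemma egf_of_covering_functions:
  fixes W :: "('a \<Rightarrow> 'b) \<Rightarrow> real"
  assumes V: "finite V" and B: "finite B0" "finite B" "B0 \<inter> B = {}"
    and all: "\<And>E. E \<subseteq> B \<Longrightarrow> (\<Sum>f\<in>V \<rightarrow>\<^sub>E B0 \<union> E. W f) = fact n * fps_nth (\<kappa> * X ^ card E) n"
    and CE: "C \<subseteq> B" "E \<subseteq> B" "C \<inter> E = {}"
  shows "(\<Sum>f\<in>{f \<in> V \<rightarrow>\<^sub>E B0 \<union> E \<union> C. C \<subseteq> f ` V}. W f) =
    fact n * fps_nth (\<kappa> * X ^ card E * (X - 1) ^ card C) n"
proof -
  have "finite C" using CE(1) B(2) by (rule finite_subset)
  then show ?thesis using CE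
  proof (induction C arbitrary: E rule: finite_induct)
    case empty
    then show ?case using all[of E] by simp
  next
    case (insert c C)
    have fE: "finite E" using insert.prems(2) B(2) by (rule finite_subset)
    let ?S = "\<lambda>E. {f \<in> V \<rightarrow>\<^sub>E B0 \<union> E \<union> C. C \<subseteq> f ` V}"
    have c: "c \<notin> B0 \<union> E \<union> C" using insert B(3) by auto
    have "{f \<in> V \<rightarrow>\<^sub>E B0 \<union> E \<union> insert c C. insert c C \<subseteq> f ` V} = ?S (insert c E) - ?S E"
    proof (intro set_eqI iffI)
      fix f assume f: "f \<in> {f \<in> V \<rightarrow>\<^sub>E B0 \<union> E \<union> insert c C. insert c C \<subseteq> f ` V}"
      then obtain i where "i \<in> V" "f i = c" by auto
      then have "f \<notin> V \<rightarrow>\<^sub>E B0 \<union> E \<union> C" using c by auto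
      then show "f \<in> ?S (insert c E) - ?S E" using f by auto
    next
      fix f assume f: "f \<in> ?S (insert c E) - ?S E"
      then have "c \<in> f ` V" by (auto simp: PiE_def Pi_def)
      then show "f \<in> {f \<in> V \<rightarrow>\<^sub>E B0 \<union> E \<union> insert c C. insert c C \<subseteq> f ` V}"
        using f by auto
    qed
    moreover have "finite (?S (insert c E))"
      using V fE B(1) insert.hyps(1) by (intro finite_Collect_conjI disjI1) (auto intro: finite_PiE)
    moreover have "?S E \<subseteq> ?S (insert c E)" by auto
    ultimately have "(\<Sum>f\<in>{f \<in> V \<rightarrow>\<^sub>E B0 \<union> E \<union> insert c C. insert c C \<subseteq> f ` V}. W f) =
        (\<Sum>f\<in>?S (insert c E). W f) - (\<Sum>f\<in>?S E. W f)"
      by (simp only: sum_diff)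
    also have "\<dots> = fact n * fps_nth (\<kappa> * X ^ card (insert c E) * (X - 1) ^ card C
        - \<kappa> * X ^ card E * (X - 1) ^ card C) n"
      using insert.IH[of "insert c E"] insert.IH[of E] insert.prems insert.hyps
      by (simp add: algebra_simps)
    also have "\<kappa> * X ^ card (insert c E) * (X - 1) ^ card C - \<kappa> * X ^ card E * (X - 1) ^ card C
        = \<kappa> * X ^ card E * (X - 1) ^ card (insert c C)"
      using fE c insert.hyps by (simp add: algebra_simps)
    finally show ?case .
  qed
qed

lemma canonical_split:
  fixes g :: "('a \<Rightarrow> nat) \<Rightarrow> 'c::comm_monoid_add"
  assumes "cone_building V D"
  shows "(\<Sum>r\<in>canonical_weights V D. g r) =
    (\<Sum>K\<le>card V. \<Sum>r\<in>{r \<in> canonical_weights V D. r ` V - {0} = {1..K}}. g r)"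
proof -
  interpret cone_building V D by fact
  have eq: "r ` V - {0} = {1..K} \<longleftrightarrow> card (r ` V - {0}) = K" if r: "r \<in> canonical_weights V D" for r K
  proof -
    obtain K' where K': "r ` V - {0} = {1..K'}"
      using r by (auto simp: canonical_weights_def)
    have "{1..K'} = {1..K} \<longleftrightarrow> K' = K" by (metis card_atLeastAtMost diff_Suc_1)
    then show ?thesis unfolding K' by simp
  qed
  have "card (r ` V - {0}) \<le> card V" for r :: "'a \<Rightarrow> nat"
    using fin_V by (meson card_Diff1_le card_image_le order_trans)
  then have "(\<Sum>r\<in>canonical_weights V D. g r) =
    (\<Sum>K\<le>card V. \<Sum>r\<in>{r \<in> canonical_weights V D. card (r ` V - {0}) = K}. g r)"
    using sum.group[OF finite_canonical, of "{..card V}" "\<lambda>r. card (r ` V - {0})" g]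
    by (simp add: image_subset_iff)
  also have "\<dots> = (\<Sum>K\<le>card V. \<Sum>r\<in>{r \<in> canonical_weights V D. r ` V - {0} = {1..K}}. g r)"
    using eq by (intro sum.cong) auto
  finally show ?thesis .
qed

text \<open>Identities of polynomials in \<open>\<alpha>\<close> and \<open>t\<close> are proved at positive integers. There real power
  series with their exponentials, inverses and derivatives are available, and division by \<open>\<alpha>\<close> and
  \<open>t\<close> is possible.\<close>

definition eval_at :: "int \<Rightarrow> int \<Rightarrow> int poly poly \<Rightarrow> real"
  where "eval_at a t p = real_of_int (poly (poly p [:a:]) t)"

lemma eval_at_simps [simp]:
  "eval_at a t (p + q) = eval_at a t p + eval_at a t q"
  "eval_at a t (p - q) = eval_at a t p - eval_at a t q"
  "eval_at a t (p * q) = eval_at a t p * eval_at a t q"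
  "eval_at a t (p ^ k) = eval_at a t p ^ k"
  "eval_at a t 0 = 0" "eval_at a t 1 = 1"
  "eval_at a t (of_nat m) = of_nat m"
  "eval_at a t (numeral w) = numeral w"
  "eval_at a t var_alpha = of_int a"
  "eval_at a t var_t = of_int t"
  "eval_at a t [:[:c:]:] = of_int c"
  "eval_at a t (smult [:c:] p) = of_int c * eval_at a t p"
  by (simp_all add: eval_at_def var_alpha_def var_t_def of_nat_poly numeral_poly)

lemma eval_at_sum: "eval_at a t (\<Sum>i\<in>A. f i) = (\<Sum>i\<in>A. eval_at a t (f i))"
  by (simp add: eval_at_def poly_sum)

lemma eq_if_eval_at_eq:
  assumes "\<And>a t. a > 0 \<Longrightarrow> t > 0 \<Longrightarrow> eval_at a t p = eval_at a t q"
  shows "p = q"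
proof -
  have inf: "infinite {0::int<..}" by (rule infinite_Ioi)
  have "poly (p - q) [:a:] = 0" if a: "a > 0" for a
  proof (rule ccontr)
    assume n: "poly (p - q) [:a:] \<noteq> 0"
    have "{0<..} \<subseteq> {t. poly (poly (p - q) [:a:]) t = 0}"
      using assms[OF a] by (auto simp: eval_at_def)
    then show False using poly_roots_finite[OF n] inf finite_subset by blast
  qed
  then have "(\<lambda>a. [:a:]) ` {0<..} \<subseteq> {x. poly (p - q) x = 0}" by auto
  moreover have "infinite ((\<lambda>a::int. [:a:]) ` {0<..})"
    using inf by (subst finite_image_iff) (auto intro: inj_onI)
  ultimately have "p - q = 0" using poly_roots_finite finite_subset by blast
  then show ?thesis by simp
qed

lemma fps_geometric_partial_sum:
  fixes y :: "'a::field fps"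
  assumes "fps_nth y 0 = 0"
  shows "(\<Sum>k\<le>n. fps_nth (\<kappa> * y ^ k) n) = fps_nth (\<kappa> * inverse (1 - y)) n"
proof -
  have inv: "inverse (1 - y) * (1 - y) = 1" using assms by (intro inverse_mult_eq_1) simp
  have "(1 - y) * (\<Sum>k\<le>n. y ^ k) = 1 - y ^ Suc n"
    using sum_gp_basic[of y n] .
  then have "inverse (1 - y) * (1 - y) * (\<Sum>k\<le>n. y ^ k) = inverse (1 - y) * (1 - y ^ Suc n)"
    by (simp only: mult.assoc)
  then have "(\<Sum>k\<le>n. y ^ k) = inverse (1 - y) - inverse (1 - y) * y ^ Suc n"
    unfolding inv by (simp add: algebra_simps)
  then have "\<kappa> * (\<Sum>k\<le>n. y ^ k) = \<kappa> * inverse (1 - y) - \<kappa> * inverse (1 - y) * y ^ Suc n"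
    by (simp only: right_diff_distrib mult.assoc)
  moreover have "fps_nth (f * y ^ Suc n) n = 0" for f
    unfolding fps_mult_nth using startsby_zero_power_prefix[OF assms, of "Suc n"]
    by (intro sum.neutral) auto
  ultimately have "fps_nth (\<kappa> * (\<Sum>k\<le>n. y ^ k)) n = fps_nth (\<kappa> * inverse (1 - y)) n"
    by simp
  then show ?thesis by (simp add: sum_distrib_left fps_sum_nth)
qed

text \<open>The generating function of chains of nonempty blocks, or ordered set partitions, with weight \<open>t\<close>
  for each block and \<open>a\<close> for each element of a block beyond the first.\<close>

definition chain_egf :: "real \<Rightarrow> real \<Rightarrow> real fps"
  where "chain_egf a t = inverse (1 - fps_const (t / a) * (fps_exp a - 1))"

text \<open>A face of the permutohedron is a nonempty chain of blocks in which one block carries no factor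
  \<open>t\<close>.\<close>

definition perm_egf :: "real \<Rightarrow> real \<Rightarrow> real fps"
  where "perm_egf a t = fps_const (1 / t) * (chain_egf a t - 1)"

text \<open>A leaf of the star lies below the centre (factor \<open>t\<close>), level with it (factor \<open>a\<close>), or in a
  chain of blocks above it.\<close>

definition stell_egf :: "real \<Rightarrow> real \<Rightarrow> real fps"
  where "stell_egf a t = fps_exp (a + t) * chain_egf a t"

text \<open>The sum over the number \<open>k\<close> of blocks may be cut off at \<open>n\<close>, because \<open>exp (a x) - 1\<close> has no
  constant term.\<close>

lemma chain_sum:
  "(\<Sum>k\<le>n. (t / a) ^ k * fps_nth (\<kappa> * (fps_exp a - 1) ^ k) n) = fps_nth (\<kappa> * chain_egf a t) n"
proof -
  have "(t / a) ^ k * fps_nth (\<kappa> * (fps_exp a - 1) ^ k) n =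
      fps_nth (\<kappa> * (fps_const (t / a) * (fps_exp a - 1)) ^ k) n" for k
    by (simp add: power_mult_distrib mult.left_commute[of \<kappa>])
  then show ?thesis unfolding chain_egf_def by (simp add: fps_geometric_partial_sum)
qed

lemma eval_at_F_complete:
  assumes V: "finite V" "V \<noteq> {}" and a: "a \<noteq> 0" and t: "t \<noteq> 0"
  shows "eval_at a t (\<Sum>r\<in>canonical_weights V {}.
      var_alpha ^ (card V - weight_codim V r) * var_t ^ (weight_codim V r - 1)) =
    fact (card V) * fps_nth (perm_egf a t) (card V)" (is "eval_at a t (\<Sum>r\<in>_. ?m r) = _")
proof -
  let ?n = "card V" and ?A = "real_of_int a" and ?T = "real_of_int t"
  have n: "?n \<noteq> 0" using V by simp
  have cb: "cone_building V {}" using V by unfold_locales auto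
  have set: "{r \<in> canonical_weights V {}. r ` V - {0} = {1..K}} =
      {f \<in> V \<rightarrow>\<^sub>E {} \<union> {} \<union> {1..K}. {1..K} \<subseteq> f ` V}" for K :: nat
  proof (intro set_eqI iffI)
    fix r assume "r \<in> {r \<in> canonical_weights V {}. r ` V - {0} = {1..K}}"
    then have r: "r \<in> extensional V" "0 \<notin> r ` V" "r ` V - {0} = {1..K}"
      by (auto simp: canonical_weights_def)
    then have "r ` V = {1..K}" by simp
    then show "r \<in> {f \<in> V \<rightarrow>\<^sub>E {} \<union> {} \<union> {1..K}. {1..K} \<subseteq> f ` V}"
      using r(1) by (auto simp: PiE_def)
  next
    fix r assume r: "r \<in> {f \<in> V \<rightarrow>\<^sub>E {} \<union> {} \<union> {1..K}. {1..K} \<subseteq> f ` V}"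
    then have "r ` V = {1..K}" by (auto simp: PiE_def Pi_def)
    then show "r \<in> {r \<in> canonical_weights V {}. r ` V - {0} = {1..K}}"
      using r by (auto simp: canonical_weights_def PiE_def)
  qed
  have count: "(\<Sum>f\<in>{f \<in> V \<rightarrow>\<^sub>E {} \<union> {} \<union> {1..K}. {1..K} \<subseteq> f ` V}. ?A ^ ?n) =
      fact ?n * fps_nth (1 * fps_exp ?A ^ card ({}::nat set) * (fps_exp ?A - 1) ^ card {1..K}) ?n" for K :: nat
  proof (rule egf_of_covering_functions[where B = "{1..K}"])
    fix E :: "nat set" assume "E \<subseteq> {1..K}"
    then have "finite E" using finite_subset by blast
    then show "(\<Sum>f\<in>V \<rightarrow>\<^sub>E {} \<union> E. ?A ^ ?n) = fact ?n * fps_nth (1 * fps_exp ?A ^ card E) ?n"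
      using V by (simp add: card_PiE fps_exp_power_mult power_mult_distrib)
  qed (use V in auto)
  have "eval_at a t (\<Sum>r\<in>canonical_weights V {}. ?m r) =
      (\<Sum>K\<le>?n. \<Sum>r\<in>{r \<in> canonical_weights V {}. r ` V - {0} = {1..K}}. eval_at a t (?m r))"
    by (simp only: eval_at_sum canonical_split[OF cb])
  also have "\<dots> = (\<Sum>K\<le>?n. \<Sum>r\<in>{r \<in> canonical_weights V {}. r ` V - {0} = {1..K}}.
      1 / ?T * (?T / ?A) ^ K * ?A ^ ?n)"
  proof (intro sum.cong refl)
    fix K r assume K: "K \<in> {..?n}" and r: "r \<in> {r \<in> canonical_weights V {}. r ` V - {0} = {1..K}}"
    then have Z: "{i\<in>V. r i = 0} = {}" by (force simp: canonical_weights_def)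
    have c: "weight_codim V r = K" using r unfolding weight_codim_def Z by simp
    then have "K \<ge> 1" using cone_building.weight_codim_pos[OF cb, of r] by simp
    then have "?T ^ (K - 1) = ?T ^ K / ?T" using t by (simp add: power_diff)
    moreover have "?A ^ (?n - K) = ?A ^ ?n / ?A ^ K" using K a by (simp add: power_diff)
    ultimately show "eval_at a t (?m r) = 1 / ?T * (?T / ?A) ^ K * ?A ^ ?n"
      by (simp add: c power_divide mult_ac)
  qed
  also have "\<dots> = (\<Sum>K\<le>?n. 1 / ?T * (?T / ?A) ^ K * (fact ?n * fps_nth ((fps_exp ?A - 1) ^ K) ?n))"
    unfolding set sum_distrib_left[symmetric] count by simp
  also have "\<dots> = 1 / ?T * fact ?n * (\<Sum>K\<le>?n. (?T / ?A) ^ K * fps_nth (1 * (fps_exp ?A - 1) ^ K) ?n)"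
    by (simp add: sum_distrib_left mult_ac)
  also have "\<dots> = 1 / ?T * fact ?n * fps_nth (1 * chain_egf ?A ?T) ?n"
    by (simp only: chain_sum)
  also have "\<dots> = fact ?n * fps_nth (perm_egf ?A ?T) ?n"
    using n by (simp add: perm_egf_def)
  finally show ?thesis .
qed

text \<open>The weight \<open>\<beta>\<close> below vanishes on functions with a wrong value at the centre. In this way they need
  not be excluded from the sum, which is then one over functions that cover \<open>{2..K}\<close> and take
  values in \<open>{0..K}\<close>.\<close>

lemma eval_at_F_star:
  assumes V: "finite V" "c \<notin> V" and a: "a \<noteq> 0" and t: "t \<noteq> 0"
  shows "eval_at a t (\<Sum>r\<in>canonical_weights (insert c V) {c}.
      var_alpha ^ (card (insert c V) - weight_codim (insert c V) r) *
      var_t ^ (weight_codim (insert c V) r - 1)) =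
    fact (card V) * fps_nth (stell_egf a t) (card V)" (is "eval_at a t (\<Sum>r\<in>_. ?m r) = _")
proof -
  let ?V = "insert c V"
  let ?n = "card V" and ?A = "real_of_int a" and ?T = "real_of_int t"
  have cb: "cone_building ?V {c}" using V by unfold_locales auto
  define \<beta> where "\<beta> i v = (if i = c then if v = 1 then 1 else 0 else if v = 0 then ?T else ?A)" for i and v :: nat
  let ?W = "\<lambda>r. \<Prod>i\<in>?V. \<beta> i (r i)"
  let ?S = "\<lambda>K. {r \<in> canonical_weights ?V {c}. r ` ?V - {0} = {1..K}}"
  let ?S' = "\<lambda>K::nat. {f \<in> ?V \<rightarrow>\<^sub>E {0, 1} \<union> {} \<union> {2..K}. {2..K} \<subseteq> f ` ?V}"
  have W0: "?W r = 0" if "r c \<noteq> 1" for r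
    using V that by (simp add: \<beta>_def)
  have S0: "?S 0 = {}" by (auto simp: canonical_weights_def)
  have set: "?S (Suc k) = {r \<in> ?S' (Suc k). r c = 1}" for k
  proof (intro set_eqI iffI)
    fix r assume "r \<in> ?S (Suc k)"
    then have r: "r \<in> extensional ?V" "r c = 1" "r ` ?V - {0} = {1..Suc k}"
      by (auto simp: canonical_weights_def)
    have "r ` ?V \<subseteq> insert 0 {1..Suc k}" unfolding r(3)[symmetric] by auto
    also have "\<dots> \<subseteq> {0, 1} \<union> {} \<union> {2..Suc k}" by auto
    finally have "r ` ?V \<subseteq> {0, 1} \<union> {} \<union> {2..Suc k}" .
    then have "r \<in> ?V \<rightarrow>\<^sub>E {0, 1} \<union> {} \<union> {2..Suc k}"
      using r(1) unfolding PiE_def by auto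
    moreover have "{2..Suc k} \<subseteq> {1..Suc k}" by auto
    then have "{2..Suc k} \<subseteq> r ` ?V" using r(3) by blast
    ultimately show "r \<in> {r \<in> ?S' (Suc k). r c = 1}" using r(2) by blast
  next
    fix r assume r: "r \<in> {r \<in> ?S' (Suc k). r c = 1}"
    then have "r \<in> ?V \<rightarrow> {0, 1} \<union> {} \<union> {2..Suc k}" by (auto simp: PiE_def)
    then have "r ` ?V \<subseteq> {0, 1} \<union> {} \<union> {2..Suc k}" by (rule funcset_image)
    moreover have "1 \<in> r ` ?V" using r by force
    moreover have "{2..Suc k} \<subseteq> r ` ?V" using r by blast
    moreover have "{1..Suc k} = insert 1 {2..Suc k}" by auto
    moreover have "0 \<notin> {1..Suc k}" by simp
    moreover have "A - {0} = I"
      if "A \<subseteq> {0, 1} \<union> {} \<union> J" "1 \<in> A" "J \<subseteq> A" "I = insert 1 J" "0 \<notin> I" for A I J :: "nat set"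
      using that by blast
    ultimately have im: "r ` ?V - {0} = {1..Suc k}" by metis
    moreover have "r \<in> extensional ?V" "r c = 1" using r by (simp_all add: PiE_def)
    ultimately have "r \<in> canonical_weights ?V {c}"
      unfolding canonical_weights_def by blast
    then show "r \<in> ?S (Suc k)" using im by blast
  qed
  have count: "(\<Sum>f\<in>?S' (Suc k). ?W f) =
      fact ?n * fps_nth (fps_exp (?A + ?T) * fps_exp ?A ^ card ({}::nat set) * (fps_exp ?A - 1) ^ card {2..Suc k}) ?n" for k
  proof (rule egf_of_covering_functions[where B = "{2..Suc k}"])
    fix E :: "nat set" assume E: "E \<subseteq> {2..Suc k}"
    then have fE: "finite E" using finite_subset by blast
    have E01: "0 \<notin> E" "1 \<notin> E" using E by auto
    have "(\<Sum>f\<in>?V \<rightarrow>\<^sub>E {0, 1} \<union> E. ?W f) = (\<Prod>i\<in>?V. \<Sum>v\<in>{0, 1} \<union> E. \<beta> i v)"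
      using V fE by (intro prod_sum_PiE[symmetric]) auto
    also have "\<dots> = (\<Prod>i\<in>?V. if i = c then 1 else ?T + ?A + card E * ?A)"
    proof (intro prod.cong refl)
      fix i
      have "(\<Sum>v\<in>{0, 1} \<union> E. \<beta> i v) = \<beta> i 0 + \<beta> i 1 + (\<Sum>v\<in>E. \<beta> i v)"
        using fE E01 by simp
      also have "(\<Sum>v\<in>E. \<beta> i v) = (\<Sum>v\<in>E. if i = c then 0 else ?A)"
        using E01 by (intro sum.cong) (auto simp: \<beta>_def)
      finally show "(\<Sum>v\<in>{0, 1} \<union> E. \<beta> i v) = (if i = c then 1 else ?T + ?A + card E * ?A)"
        by (simp add: \<beta>_def)
    qed
    also have "\<dots> = (\<Prod>i\<in>V. if i = c then 1 else ?T + ?A + card E * ?A)"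
      unfolding prod.insert[OF V] by simp
    also have "\<dots> = (\<Prod>i\<in>V. ?T + ?A + card E * ?A)"
      using V by (intro prod.cong) auto
    also have "\<dots> = fact ?n * fps_nth (fps_exp (?A + ?T) * fps_exp ?A ^ card E) ?n"
      by (simp add: fps_exp_power_mult add_ac flip: fps_exp_add_mult)
    finally show "(\<Sum>f\<in>?V \<rightarrow>\<^sub>E {0, 1} \<union> E. ?W f) =
      fact ?n * fps_nth (fps_exp (?A + ?T) * fps_exp ?A ^ card E) ?n" .
  qed (use V in auto)
  have fin: "finite (?S' K)" for K
    using V by (intro finite_Collect_conjI disjI1) (auto intro: finite_PiE)
  have mon: "eval_at a t (?m r) = (?T / ?A) ^ k * ?W r" if r: "r \<in> ?S (Suc k)" for r k
  proof -
    let ?Z = "{i\<in>V. r i = 0}"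
    have rc: "r c = 1" using r by (simp add: canonical_weights_def)
    have "{i\<in>?V. r i = 0} = ?Z" using rc by auto
    then have cod: "weight_codim ?V r = Suc k + card ?Z"
      using r unfolding weight_codim_def by simp
    have "?W r = (\<Prod>i\<in>V. \<beta> i (r i))" using V rc by (simp add: \<beta>_def)
    also have "\<dots> = (\<Prod>i\<in>V. if r i = 0 then ?T else ?A)"
      using V by (intro prod.cong) (auto simp: \<beta>_def)
    also have "\<dots> = ?T ^ card ?Z * ?A ^ card {i\<in>V. r i \<noteq> 0}"
      using V by (simp add: prod.If_cases Int_def)
    finally have W: "?W r = ?T ^ card ?Z * ?A ^ card {i\<in>V. r i \<noteq> 0}" .
    have split: "card V = card {i\<in>V. r i \<noteq> 0} + card ?Z"
    proof -
      have "card ({i\<in>V. r i \<noteq> 0} \<union> ?Z) = card {i\<in>V. r i \<noteq> 0} + card ?Z"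
        using V by (intro card_Un_disjoint) auto
      moreover have "{i\<in>V. r i \<noteq> 0} \<union> ?Z = V" by auto
      ultimately show ?thesis by simp
    qed
    have "{2..Suc k} \<subseteq> r ` {i\<in>V. r i \<noteq> 0}"
    proof
      fix v assume v: "v \<in> {2..Suc k}"
      then have "v \<in> {1..Suc k}" by simp
      then have "v \<in> r ` ?V - {0}" using r by blast
      then show "v \<in> r ` {i\<in>V. r i \<noteq> 0}" using v rc by auto
    qed
    then have "card {2..Suc k} \<le> card {i\<in>V. r i \<noteq> 0}"
      using V(1) by (intro surj_card_le) auto
    then have k: "k \<le> card {i\<in>V. r i \<noteq> 0}" by simp
    have "card ?V - weight_codim ?V r = card {i\<in>V. r i \<noteq> 0} - k"
      using V split by (simp add: cod)
    then show ?thesis unfolding W using k a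
      by (simp add: cod power_diff power_add power_divide)
  qed
  have "eval_at a t (\<Sum>r\<in>canonical_weights ?V {c}. ?m r) = (\<Sum>K\<le>Suc ?n. \<Sum>r\<in>?S K. eval_at a t (?m r))"
    using V by (simp only: eval_at_sum canonical_split[OF cb]) simp
  also have "\<dots> = (\<Sum>k\<le>?n. \<Sum>r\<in>?S (Suc k). eval_at a t (?m r))"
    unfolding sum.atMost_Suc_shift S0 by simp
  also have "\<dots> = (\<Sum>k\<le>?n. (?T / ?A) ^ k * (\<Sum>r\<in>?S (Suc k). ?W r))"
    unfolding sum_distrib_left by (intro sum.cong refl mon)
  also have "\<dots> = (\<Sum>k\<le>?n. (?T / ?A) ^ k * (\<Sum>r\<in>?S' (Suc k). ?W r))"
  proof (rule sum.cong[OF refl])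
    fix k
    have "(\<Sum>r\<in>?S (Suc k). ?W r) = (\<Sum>r\<in>?S' (Suc k). ?W r)"
      unfolding set using fin W0 by (intro sum.mono_neutral_left) auto
    then show "(?T / ?A) ^ k * (\<Sum>r\<in>?S (Suc k). ?W r) = (?T / ?A) ^ k * (\<Sum>r\<in>?S' (Suc k). ?W r)"
      by (simp only:)
  qed
  also have "\<dots> = fact ?n * (\<Sum>k\<le>?n. (?T / ?A) ^ k * fps_nth (fps_exp (?A + ?T) * (fps_exp ?A - 1) ^ k) ?n)"
    unfolding count by (simp add: sum_distrib_left mult_ac)
  also have "\<dots> = fact ?n * fps_nth (stell_egf ?A ?T) ?n"
    by (simp only: chain_sum stell_egf_def)
  finally show ?thesis .
qed

section \<open>Recursions for the face polynomials\<close>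

text \<open>With \<open>G = 1 / (1 - t u)\<close> and \<open>u' = exp (a x) = 1 + a u\<close> everything follows from \<open>G' = t u' G\<^sup>2\<close>
  and \<open>u G = p\<close>.\<close>

lemma chain_egf_ode:
  fixes a t :: real
  assumes "a \<noteq> 0" "t \<noteq> 0"
  defines "p \<equiv> perm_egf a t"
  shows "chain_egf a t = 1 + fps_const t * p"
    and "fps_deriv p = (1 + fps_const t * p) * (1 + fps_const (a + t) * p)"
    and "fps_deriv (stell_egf a t) =
      stell_egf a t * (fps_const (a + 2 * t) + fps_const (t * (a + t)) * p)"
proof -
  let ?G = "chain_egf a t" and ?X = "fps_exp a" and ?c = "fps_const :: real \<Rightarrow> real fps"
  let ?D = "1 - ?c (t / a) * (?X - 1)"
  have D0: "fps_nth ?D 0 \<noteq> 0" by simp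
  have at: "?c a * ?c (t / a) = ?c t" using assms by simp
  show G: "?G = 1 + ?c t * p"
  proof -
    have c: "?c t * (?c (1 / t) * y) = y" for y
      using assms(2) by (simp add: mult.assoc[symmetric])
    show ?thesis unfolding p_def perm_egf_def c by simp
  qed
  have GD: "?G * ?D = 1" unfolding chain_egf_def by (rule inverse_mult_eq_1[OF D0])
  have dD: "fps_deriv ?D = - (?c t * ?X)"
    using assms(1) by (simp add: mult.assoc[symmetric])
  have "fps_deriv ?G = - fps_deriv ?D * ?G\<^sup>2"
    unfolding chain_egf_def by (rule fps_inverse_deriv[OF D0])
  then have dG: "fps_deriv ?G = ?c t * ?X * ?G\<^sup>2" unfolding dD by simp
  have "?c t * ?X * ?G = ?c t * ?G + ?c a * ((1 - ?D) * ?G)"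
  proof -
    have "?c a * (1 - ?D) = ?c t * (?X - 1)" using at by (simp add: mult.assoc[symmetric] del: fps_const_mult)
    then have "?c a * ((1 - ?D) * ?G) = ?c t * (?X - 1) * ?G" by (simp only: mult.assoc[symmetric])
    then show ?thesis by (simp add: algebra_simps)
  qed
  also have "(1 - ?D) * ?G = ?G - 1"
  proof -
    have "(1 - d) * g = g - g * d" for d g :: "real fps" by (simp add: algebra_simps)
    then show ?thesis by (simp only: GD)
  qed
  also have "?c t * ?G + ?c a * (?G - 1) = ?c t * (1 + ?c (a + t) * p)"
    unfolding G by (simp add: algebra_simps flip: fps_const_add)
  finally have XG: "?c t * ?X * ?G = ?c t * (1 + ?c (a + t) * p)" .
  have dG': "fps_deriv ?G = ?c t * ((1 + ?c t * p) * (1 + ?c (a + t) * p))"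
  proof -
    have "fps_deriv ?G = (?c t * ?X * ?G) * ?G" unfolding dG by (simp add: power2_eq_square mult_ac)
    then show ?thesis unfolding XG by (simp add: G mult_ac)
  qed
  have "?c t * fps_deriv p = fps_deriv ?G" unfolding G by simp
  then have "?c t * fps_deriv p = ?c t * ((1 + ?c t * p) * (1 + ?c (a + t) * p))" unfolding dG' .
  then show "fps_deriv p = (1 + ?c t * p) * (1 + ?c (a + t) * p)"
    using assms(2) by simp
  have "fps_deriv (stell_egf a t) = ?c (a + t) * stell_egf a t + fps_exp (a + t) * ((?c t * ?X * ?G) * ?G)"
    unfolding stell_egf_def by (simp add: dG power2_eq_square algebra_simps)
  also have "\<dots> = stell_egf a t * (?c (a + t) + ?c t * (1 + ?c (a + t) * p))"
    unfolding XG by (simp add: stell_egf_def algebra_simps)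
  also have "?c (a + t) + ?c t * (1 + ?c (a + t) * p) = ?c (a + 2 * t) + ?c (t * (a + t)) * p"
    by (simp add: algebra_simps flip: fps_const_add fps_const_mult)
  finally show "fps_deriv (stell_egf a t) =
      stell_egf a t * (?c (a + 2 * t) + ?c (t * (a + t)) * p)" .
qed

lemma fact_mult_fps_nth_mult:
  fixes f g :: "'a::field_char_0 fps"
  shows "fact n * fps_nth (f * g) n =
    (\<Sum>k\<le>n. of_nat (n choose k) * (fact k * fps_nth f k) * (fact (n - k) * fps_nth g (n - k)))"
  unfolding fps_mult_nth sum_distrib_left atMost_atLeast0
  by (intro sum.cong) (simp_all add: binomial_fact)

lemma fact_mult_fps_nth_deriv:
  fixes f :: "'a::field_char_0 fps"
  shows "fact n * fps_nth (fps_deriv f) n = fact (Suc n) * fps_nth f (Suc n)"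
  by (simp add: mult_ac)

lemma fps_nth_perm_egf_0: "fps_nth (perm_egf a t) 0 = 0"
  by (simp add: perm_egf_def chain_egf_def)

text \<open>The series \<open>p\<close> has no constant term, which removes the last summand of the binomial convolution.\<close>

lemma egf_recursion:
  fixes f :: "real fps"
  assumes "n \<ge> 1"
  shows "fact (n - 1) * fps_nth (f * perm_egf a t) (n - 1) =
    (\<Sum>i=1..n-1. of_nat ((n - 1) choose (i - 1)) * (fact (i - 1) * fps_nth f (i - 1)) *
      (fact (n - i) * fps_nth (perm_egf a t) (n - i)))" (is "_ = (\<Sum>i=1..n-1. ?g i)")
proof -
  obtain m where m: "n = Suc m" using assms by (cases n) auto
  have "fact (n - 1) * fps_nth (f * perm_egf a t) (n - 1) = (\<Sum>k\<le>m. ?g (Suc k))"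
    by (simp add: m fact_mult_fps_nth_mult)
  also have "\<dots> = (\<Sum>k<m. ?g (Suc k))"
    by (simp add: m fps_nth_perm_egf_0 flip: lessThan_Suc_atMost)
  also have "\<dots> = (\<Sum>i=1..n-1. ?g i)"
    by (rule sum.reindex_bij_witness[of _ "\<lambda>i. i - 1" Suc]) (auto simp: m)
  finally show ?thesis .
qed

lemma simplex_sum_graph_associahedron:
  assumes "cone_building V D" "building_set m E = cones V D"
  shows "graph_associahedron m E = simplex_sum.sum_polytope (cones V D) id"
proof -
  interpret cone_building V D by fact
  show ?thesis by (simp add: graph_associahedron_def sum_polytope_def assms(2))
qed

lemma building_set_complete: "building_set m (complete_graph m) = cones {1..m} {}"
proof -
  have "induced_connected (complete_graph m) S" if "S \<subseteq> {1..m}" for S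
    unfolding induced_connected_def
  proof (intro ballI)
    fix u v assume uv: "u \<in> S" "v \<in> S"
    have "(u, v) \<in> complete_graph m \<inter> S \<times> S" if "u \<noteq> v"
      using uv that \<open>S \<subseteq> {1..m}\<close> by (auto simp: complete_graph_def)
    then show "(u, v) \<in> (complete_graph m \<inter> S \<times> S)\<^sup>*"
      by (cases "u = v") auto
  qed
  then show ?thesis by (auto simp: building_set_def cones_def)
qed

lemma building_set_star: "building_set m (star_graph m) = cones {1..m} {1}"
proof -
  have "induced_connected (star_graph m) S \<longleftrightarrow> 1 \<in> S \<or> (\<exists>i. S = {i})"
    if S: "S \<subseteq> {1..m}" "S \<noteq> {}" for S
  proof
    assume conn: "induced_connected (star_graph m) S"
    show "1 \<in> S \<or> (\<exists>i. S = {i})"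
    proof (rule disjCI)
      assume no: "\<not> (\<exists>i. S = {i})"
      obtain u where u: "u \<in> S" using S by auto
      then obtain v where v: "v \<in> S" "v \<noteq> u" using no by blast
      then have "(u, v) \<in> (star_graph m \<inter> S \<times> S)\<^sup>*"
        using conn u by (auto simp: induced_connected_def)
      then obtain x y where "(x, y) \<in> star_graph m \<inter> S \<times> S"
        using v(2) by (metis converse_rtranclE)
      then show "1 \<in> S" by (auto simp: star_graph_def)
    qed
  next
    assume "1 \<in> S \<or> (\<exists>i. S = {i})"
    then show "induced_connected (star_graph m) S"
    proof
      assume 1: "1 \<in> S"
      have edge: "(u, 1) \<in> (star_graph m \<inter> S \<times> S)\<^sup>*" "(1, u) \<in> (star_graph m \<inter> S \<times> S)\<^sup>*" if "u \<in> S" for u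
        using that 1 S by (cases "u = 1"; force simp: star_graph_def)+
      show ?thesis unfolding induced_connected_def
        by (intro ballI) (rule rtrancl_trans[OF edge])
    qed (auto simp: induced_connected_def)
  qed
  then show ?thesis by (auto simp: building_set_def cones_def)
qed

lemma cone_building_perm: "cone_building {1..n + 1} ({} :: nat set)"
  by unfold_locales auto

lemma cone_building_stell: "cone_building {1..n + 1} {1::nat}"
  by unfold_locales auto

lemma permutohedron_eq: "permutohedron n = simplex_sum.sum_polytope (cones {1..n + 1} {}) id"
  unfolding permutohedron_def
  by (rule simplex_sum_graph_associahedron[OF cone_building_perm building_set_complete])

lemma stellohedron_eq: "stellohedron n = simplex_sum.sum_polytope (cones {1..n + 1} {1}) id"
  unfolding stellohedron_def
  by (rule simplex_sum_graph_associahedron[OF cone_building_stell building_set_star])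

lemma convex_dim_permutohedron: "convex_dim (permutohedron n) = n"
  unfolding permutohedron_eq cone_building.convex_dim_polytope[OF cone_building_perm] by simp

lemma convex_dim_stellohedron: "convex_dim (stellohedron n) = n"
  unfolding stellohedron_eq cone_building.convex_dim_polytope[OF cone_building_stell] by simp

lemma eval_at_F_permutohedron:
  assumes "a \<noteq> 0" "t \<noteq> 0"
  shows "eval_at a t (F_poly (permutohedron n)) = fact (n + 1) * fps_nth (perm_egf a t) (n + 1)"
  using eval_at_F_complete[of "{1..n+1}" a t] assms
  unfolding permutohedron_eq cone_building.F_poly_eq[OF cone_building_perm] by simp

lemma eval_at_F_stellohedron:
  assumes "a \<noteq> 0" "t \<noteq> 0"
  shows "eval_at a t (F_poly (stellohedron n)) = fact n * fps_nth (stell_egf a t) n"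
proof -
  have "insert 1 {2..n + 1} = {1..n + 1}" by auto
  then show ?thesis
    using eval_at_F_star[of "{2..n+1}" 1 a t] assms
    unfolding stellohedron_eq cone_building.F_poly_eq[OF cone_building_stell] by simp
qed

lemma F_recursion_stellohedron:
  assumes n: "n \<ge> 1"
  shows "F_poly (stellohedron n) = (var_alpha + 2 * var_t) * F_poly (stellohedron (n - 1)) +
    (var_alpha + var_t) * var_t * (\<Sum>i=1..n-1. of_nat ((n - 1) choose (i - 1)) *
        F_poly (stellohedron (i - 1)) * F_poly (permutohedron (n - i - 1)))"
proof (rule eq_if_eval_at_eq)
  fix a t :: int assume at: "a > 0" "t > 0"
  then have nz: "a \<noteq> 0" "t \<noteq> 0" by auto
  let ?s = "stell_egf a t" and ?p = "perm_egf a t"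
  have "eval_at a t (F_poly (stellohedron n)) = fact (n - 1) * fps_nth (fps_deriv ?s) (n - 1)"
    using n at unfolding fact_mult_fps_nth_deriv by (simp add: eval_at_F_stellohedron)
  also have "\<dots> = (a + 2 * t) * (fact (n - 1) * fps_nth ?s (n - 1)) +
      t * (a + t) * (fact (n - 1) * fps_nth (?s * ?p) (n - 1))"
  proof -
    have "fps_deriv ?s = fps_const (of_int a + 2 * of_int t) * ?s + fps_const (of_int t * (of_int a + of_int t)) * (?s * ?p)"
      using chain_egf_ode(3)[of "of_int a" "of_int t"] at by (simp add: distrib_left mult_ac)
    then show ?thesis
      by (simp only: fps_add_nth fps_mult_left_const_nth) (simp add: algebra_simps)
  qed
  also have "fact (n - 1) * fps_nth (?s * ?p) (n - 1) = eval_at a t (\<Sum>i=1..n-1. of_nat ((n - 1) choose (i - 1)) *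
        F_poly (stellohedron (i - 1)) * F_poly (permutohedron (n - i - 1)))"
    unfolding egf_recursion[OF n] eval_at_sum
  proof (intro sum.cong refl)
    fix i assume "i \<in> {1..n - 1}"
    then have "n - i - 1 + 1 = n - i" by auto
    with eval_at_F_permutohedron[OF nz, of "n - i - 1"]
    have "eval_at a t (F_poly (permutohedron (n - i - 1))) = fact (n - i) * fps_nth ?p (n - i)"
      by metis
    then show "of_nat ((n - 1) choose (i - 1)) * (fact (i - 1) * fps_nth ?s (i - 1)) *
        (fact (n - i) * fps_nth ?p (n - i)) =
      eval_at a t (of_nat ((n - 1) choose (i - 1)) * F_poly (stellohedron (i - 1)) *
        F_poly (permutohedron (n - i - 1)))"
      using at by (simp add: eval_at_F_stellohedron del: diff_diff_left)
  qed
  finally show "eval_at a t (F_poly (stellohedron n)) =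
    eval_at a t ((var_alpha + 2 * var_t) * F_poly (stellohedron (n - 1)) +
    (var_alpha + var_t) * var_t * (\<Sum>i=1..n-1. of_nat ((n - 1) choose (i - 1)) *
        F_poly (stellohedron (i - 1)) * F_poly (permutohedron (n - i - 1))))"
    using at by (simp add: eval_at_F_stellohedron mult_ac)
qed

text \<open>This recursion serves only to obtain \<open>\<gamma>\<close>-expansions of the permutohedra.\<close>

lemma F_recursion_permutohedron:
  assumes n: "n \<ge> 1"
  shows "F_poly (permutohedron n) = (var_alpha + 2 * var_t) * F_poly (permutohedron (n - 1)) +
    (var_alpha + var_t) * var_t * (\<Sum>i=1..n-1. of_nat (n choose i) *
        F_poly (permutohedron (i - 1)) * F_poly (permutohedron (n - i - 1)))"
proof (rule eq_if_eval_at_eq)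
  fix a t :: int assume at: "a > 0" "t > 0"
  then have nz: "a \<noteq> 0" "t \<noteq> 0" by auto
  let ?p = "perm_egf a t"
  have "eval_at a t (F_poly (permutohedron n)) = fact n * fps_nth (fps_deriv ?p) n"
    using at unfolding fact_mult_fps_nth_deriv by (simp add: eval_at_F_permutohedron)
  also have "\<dots> = (a + 2 * t) * (fact n * fps_nth ?p n) + t * (a + t) * (fact n * fps_nth (?p * ?p) n)"
  proof -
    have "fps_deriv ?p = 1 + fps_const (of_int a + 2 * of_int t) * ?p + fps_const (of_int t * (of_int a + of_int t)) * (?p * ?p)"
      using chain_egf_ode(2)[of "of_int a" "of_int t"] at
      by (simp add: algebra_simps flip: fps_const_add fps_const_mult)
    then show ?thesis
      using n by (simp only: fps_add_nth fps_mult_left_const_nth) (simp add: algebra_simps)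
  qed
  also have "fact n * fps_nth (?p * ?p) n =
      (\<Sum>i=1..n-1. of_nat (n choose i) * (fact i * fps_nth ?p i) * (fact (n - i) * fps_nth ?p (n - i)))"
    unfolding fact_mult_fps_nth_mult
  proof (intro sum.mono_neutral_right ballI)
    fix i assume "i \<in> {..n} - {1..n - 1}"
    then have "i = 0 \<or> i = n" by auto
    then show "of_nat (n choose i) * (fact i * fps_nth ?p i) * (fact (n - i) * fps_nth ?p (n - i)) = 0"
      by (auto simp: fps_nth_perm_egf_0)
  qed auto
  also have "\<dots> = eval_at a t (\<Sum>i=1..n-1. of_nat (n choose i) *
        F_poly (permutohedron (i - 1)) * F_poly (permutohedron (n - i - 1)))"
    unfolding eval_at_sum
  proof (intro sum.cong refl)
    fix i assume "i \<in> {1..n - 1}"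
    then have "n - i - 1 + 1 = n - i" "i - 1 + 1 = i" by auto
    with eval_at_F_permutohedron[OF nz, of "n - i - 1"] eval_at_F_permutohedron[OF nz, of "i - 1"]
    have "eval_at a t (F_poly (permutohedron (n - i - 1))) = fact (n - i) * fps_nth ?p (n - i)"
      "eval_at a t (F_poly (permutohedron (i - 1))) = fact i * fps_nth ?p i"
      by metis+
    then show "of_nat (n choose i) * (fact i * fps_nth ?p i) * (fact (n - i) * fps_nth ?p (n - i)) =
      eval_at a t (of_nat (n choose i) * F_poly (permutohedron (i - 1)) *
        F_poly (permutohedron (n - i - 1)))"
      by (simp del: diff_diff_left)
  qed
  finally show "eval_at a t (F_poly (permutohedron n)) =
    eval_at a t ((var_alpha + 2 * var_t) * F_poly (permutohedron (n - 1)) +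
    (var_alpha + var_t) * var_t * (\<Sum>i=1..n-1. of_nat (n choose i) *
        F_poly (permutohedron (i - 1)) * F_poly (permutohedron (n - i - 1))))"
    using at n by (simp add: eval_at_F_permutohedron mult_ac)
qed

lemma pcompose_shift [simp]:
  "pcompose var_alpha q = q" "pcompose var_t q = var_t"
  "pcompose (of_nat m) q = of_nat m" "pcompose (numeral w) q = numeral w"
  by (simp_all add: var_alpha_def var_t_def pcompose_pCons of_nat_poly numeral_poly)

text \<open>The substitution \<open>\<alpha> \<mapsto> \<alpha> - t\<close> takes \<open>\<alpha> + 2 t\<close> to \<open>\<alpha> + t\<close> and \<open>\<alpha> + t\<close> to \<open>\<alpha>\<close>.\<close>

lemma H_recursion_stellohedron:
  assumes "n \<ge> 1"
  shows "H_poly (stellohedron n) = (var_alpha + var_t) * H_poly (stellohedron (n - 1)) +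
    var_alpha * var_t * (\<Sum>i=1..n-1. of_nat ((n - 1) choose (i - 1)) *
        H_poly (stellohedron (i - 1)) * H_poly (permutohedron (n - i - 1)))"
  unfolding H_poly_def
  by (subst F_recursion_stellohedron[OF assms])
    (simp add: pcompose_add pcompose_mult pcompose_sum)

lemma H_recursion_permutohedron:
  assumes "n \<ge> 1"
  shows "H_poly (permutohedron n) = (var_alpha + var_t) * H_poly (permutohedron (n - 1)) +
    var_alpha * var_t * (\<Sum>i=1..n-1. of_nat (n choose i) *
        H_poly (permutohedron (i - 1)) * H_poly (permutohedron (n - i - 1)))"
  unfolding H_poly_def
  by (subst F_recursion_permutohedron[OF assms])
    (simp add: pcompose_add pcompose_mult pcompose_sum)

lemma H_point:
  "H_poly (stellohedron 0) = 1" "H_poly (permutohedron 0) = 1"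
proof -
  have "F_poly (stellohedron 0) = 1"
    by (rule eq_if_eval_at_eq) (simp add: eval_at_F_stellohedron stell_egf_def chain_egf_def)
  moreover have "F_poly (permutohedron 0) = 1"
  proof (rule eq_if_eval_at_eq)
    fix a t :: int assume at: "a > 0" "t > 0"
    have "fact 0 * fps_nth (fps_deriv (perm_egf a t)) 0 = 1"
      using chain_egf_ode(2)[of "of_int a" "of_int t"] at by (simp add: fps_nth_perm_egf_0)
    then show "eval_at a t (F_poly (permutohedron 0)) = eval_at a t 1"
      using at unfolding fact_mult_fps_nth_deriv by (simp add: eval_at_F_permutohedron)
  qed
  ultimately show "H_poly (stellohedron 0) = 1" "H_poly (permutohedron 0) = 1"
    by (simp_all add: H_poly_def pcompose_1)
qed

section \<open>Gamma polynomials\<close>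

definition gamma_value :: "real \<Rightarrow> int poly \<Rightarrow> real"
  where "gamma_value x g = poly (map_poly of_int g) x"

lemma gamma_value_pCons: "gamma_value x (pCons c g) = of_int c + x * gamma_value x g"
  by (simp add: gamma_value_def map_poly_pCons)

lemma gamma_value_add: "gamma_value x (g + h) = gamma_value x g + gamma_value x h"
proof -
  have "map_poly real_of_int (g + h) = map_poly of_int g + map_poly of_int h"
    by (intro poly_eqI) (simp add: coeff_map_poly)
  then show ?thesis by (simp add: gamma_value_def)
qed

lemma gamma_value_smult: "gamma_value x (smult c g) = of_int c * gamma_value x g"
proof -
  have "map_poly real_of_int (smult c g) = smult (of_int c) (map_poly of_int g)"
    by (intro poly_eqI) (simp add: coeff_map_poly)
  then show ?thesis by (simp add: gamma_value_def)
qed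

lemma gamma_value_mult: "gamma_value x (g * h) = gamma_value x g * gamma_value x h"
proof (induction g)
  case 0
  then show ?case by (simp add: gamma_value_def)
next
  case (pCons c g)
  then show ?case
    by (simp add: mult_pCons_left gamma_value_add gamma_value_smult gamma_value_pCons algebra_simps)
qed

lemma gamma_value_sum: "gamma_value x (\<Sum>i\<in>A. g i) = (\<Sum>i\<in>A. gamma_value x (g i))"
  by (induction A rule: infinite_finite_induct) (simp_all add: gamma_value_add, simp_all add: gamma_value_def)

lemma gamma_value_of_nat: "gamma_value x (of_nat m) = of_nat m"
  by (simp add: of_nat_poly gamma_value_pCons) (simp add: gamma_value_def)

lemma gamma_value_tau: "gamma_value x var_tau = x"
  by (simp add: var_tau_def gamma_value_pCons) (simp add: gamma_value_def)

lemma poly_eq_sum_atMost: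
  fixes x :: "'a::{comm_semiring_0,semiring_1}"
  assumes "degree p \<le> n"
  shows "poly p x = (\<Sum>i\<le>n. coeff p i * x ^ i)"
  unfolding poly_altdef using assms
  by (intro sum.mono_neutral_left) (auto simp: coeff_eq_0)

definition gamma_form :: "nat \<Rightarrow> int poly \<Rightarrow> int poly poly"
  where "gamma_form d g = (\<Sum>i\<le>d div 2.
    [:[:coeff g i:]:] * (var_alpha * var_t) ^ i * (var_alpha + var_t) ^ (d - 2 * i))"

text \<open>This criterion turns products and sums of \<open>\<gamma>\<close>-expansions into products and sums of real numbers.\<close>

lemma gamma_form_iff:
  assumes "degree g \<le> d div 2"
  shows "H = gamma_form d g \<longleftrightarrow> (\<forall>a>0. \<forall>t>0. eval_at a t H =
    of_int (a + t) ^ d * gamma_value (of_int (a * t) / (of_int (a + t))\<^sup>2) g)"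
proof -
  have "eval_at a t (gamma_form d g) = of_int (a + t) ^ d * gamma_value (of_int (a * t) / (of_int (a + t))\<^sup>2) g"
    if "a > 0" "t > 0" for a t
  proof -
    let ?s = "real_of_int (a + t)" and ?q = "real_of_int (a * t)"
    have s: "?s \<noteq> 0" using that by (simp del: of_int_add)
    have "degree (map_poly real_of_int g) \<le> d div 2" using assms map_poly_degree_leq le_trans by blast
    then have "?s ^ d * gamma_value (?q / ?s\<^sup>2) g =
        (\<Sum>i\<le>d div 2. ?s ^ d * (of_int (coeff g i) * (?q / ?s\<^sup>2) ^ i))"
      unfolding gamma_value_def by (simp add: poly_eq_sum_atMost coeff_map_poly sum_distrib_left)
    also have "\<dots> = (\<Sum>i\<le>d div 2. of_int (coeff g i) * ?q ^ i * ?s ^ (d - 2 * i))"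
    proof (intro sum.cong refl)
      fix i assume "i \<in> {..d div 2}"
      then have "?s ^ (d - 2 * i) = ?s ^ d / (?s\<^sup>2) ^ i"
        using s by (simp add: power_diff power_mult del: of_int_add)
      then show "?s ^ d * (of_int (coeff g i) * (?q / ?s\<^sup>2) ^ i) = of_int (coeff g i) * ?q ^ i * ?s ^ (d - 2 * i)"
        by (simp add: power_divide del: of_int_add of_int_mult)
    qed
    also have "\<dots> = eval_at a t (gamma_form d g)"
      by (simp add: gamma_form_def eval_at_sum mult.assoc)
    finally show ?thesis ..
  qed
  then show ?thesis using eq_if_eval_at_eq[of H "gamma_form d g"] by auto
qed

text \<open>On the line \<open>\<alpha> + t = 1\<close> the form becomes \<open>g(a (1 - a))\<close>, and \<open>a (1 - a)\<close> takes infinitely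
  many values.\<close>

lemma gamma_form_inj:
  assumes "degree g \<le> d div 2" "degree h \<le> d div 2" "gamma_form d g = gamma_form d h"
  shows "g = h"
proof -
  have val: "eval_at a (1 - a) (gamma_form d g) = of_int (poly g (a * (1 - a)))" if "degree g \<le> d div 2" for a g
    using that by (simp add: gamma_form_def eval_at_sum poly_eq_sum_atMost)
  have "poly (g - h) (a * (1 - a)) = 0" for a
    using val[OF assms(1), of a] val[OF assms(2), of a] assms(3) by simp
  then have "(\<lambda>a::int. a * (1 - a)) ` {0<..} \<subseteq> {x. poly (g - h) x = 0}" by auto
  moreover have "inj_on (\<lambda>a::int. a * (1 - a)) {0<..}"
  proof (rule inj_onI)
    fix a b :: int assume ab: "a \<in> {0<..}" "b \<in> {0<..}" "a * (1 - a) = b * (1 - b)"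
    then have "(a - b) * (a + b - 1) = 0" by (simp add: algebra_simps)
    then show "a = b" using ab by auto
  qed
  then have "infinite ((\<lambda>a::int. a * (1 - a)) ` {0<..})"
    by (simp add: finite_image_iff infinite_Ioi)
  ultimately have "g - h = 0" using poly_roots_finite finite_subset by blast
  then show ?thesis by simp
qed

lemma gamma_poly_eqI:
  assumes "degree g \<le> convex_dim P div 2" "H_poly P = gamma_form (convex_dim P) g"
  shows "gamma_poly P = g"
  unfolding gamma_poly_def
proof (rule the_equality)
  fix h assume "degree h \<le> convex_dim P div 2 \<and> H_poly P = (\<Sum>i\<le>convex_dim P div 2.
      [:[:coeff h i:]:] * (var_alpha * var_t) ^ i * (var_alpha + var_t) ^ (convex_dim P - 2 * i))"
  then have h: "degree h \<le> convex_dim P div 2" "H_poly P = gamma_form (convex_dim P) h"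
    by (simp_all only: gamma_form_def)
  show "h = g"
    by (rule gamma_form_inj[OF h(1) assms(1)]) (simp only: flip: h(2) assms(2))
qed (use assms in \<open>simp only: gamma_form_def simp_thms\<close>)

definition gamma_expansion :: "nat \<Rightarrow> int poly \<Rightarrow> int poly poly \<Rightarrow> bool"
  where "gamma_expansion d g H \<longleftrightarrow> degree g \<le> d div 2 \<and> H = gamma_form d g"

lemma gamma_expansion_one: "gamma_expansion 0 1 1"
  by (simp add: gamma_expansion_def gamma_form_def one_pCons)

text \<open>Multiplication by \<open>\<alpha> + t\<close> raises the dimension by one and keeps \<open>g\<close>, multiplication by
  \<open>\<alpha> t\<close> raises it by two and multiplies \<open>g\<close> by \<open>\<tau>\<close>, and products add the dimensions. The
  dimensions in the sum match, as \<open>(i - 1) + (n - i - 1) + 2 = n\<close>.\<close>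

lemma gamma_expansion_recursion:
  assumes n: "n \<ge> 1" and H: "gamma_expansion (n - 1) g H"
    and J: "\<And>i. 1 \<le> i \<Longrightarrow> i \<le> n - 1 \<Longrightarrow> gamma_expansion (i - 1) (h i) (J i)"
    and K: "\<And>i. 1 \<le> i \<Longrightarrow> i \<le> n - 1 \<Longrightarrow> gamma_expansion (n - i - 1) (k i) (K i)"
  shows "gamma_expansion n (g + var_tau * (\<Sum>i=1..n-1. of_nat (c i) * h i * k i))
    ((var_alpha + var_t) * H + var_alpha * var_t * (\<Sum>i=1..n-1. of_nat (c i) * J i * K i))"
proof -
  let ?S = "\<Sum>i=1..n-1. of_nat (c i) * h i * k i"
  let ?x = "\<lambda>a t. real_of_int (a * t) / (of_int (a + t))\<^sup>2"
  have eval_H: "eval_at a t H = of_int (a + t) ^ (n - 1) * gamma_value (?x a t) g" if "a > 0" "t > 0" for a t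
    using H gamma_form_iff[of g "n - 1" H] that unfolding gamma_expansion_def by blast
  have eval_J: "eval_at a t (J i) = of_int (a + t) ^ (i - 1) * gamma_value (?x a t) (h i)"
    if "a > 0" "t > 0" "1 \<le> i" "i \<le> n - 1" for a t i
    using J[OF that(3,4)] gamma_form_iff[of "h i" "i - 1" "J i"] that unfolding gamma_expansion_def by blast
  have eval_K: "eval_at a t (K i) = of_int (a + t) ^ (n - i - 1) * gamma_value (?x a t) (k i)"
    if "a > 0" "t > 0" "1 \<le> i" "i \<le> n - 1" for a t i
    using K[OF that(3,4)] gamma_form_iff[of "k i" "n - i - 1" "K i"] that unfolding gamma_expansion_def by blast
  have deg: "degree (g + var_tau * ?S) \<le> n div 2"
  proof (rule degree_add_le)
    have "degree g \<le> (n - 1) div 2" using H by (simp add: gamma_expansion_def)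
    also have "\<dots> \<le> n div 2" by (intro div_le_mono) simp
    finally show "degree g \<le> n div 2" .
    show "degree (var_tau * ?S) \<le> n div 2"
    proof (cases "n \<ge> 2")
      case True
      have "degree ?S \<le> n div 2 - 1"
      proof (rule degree_sum_le)
        fix i assume i: "i \<in> {1..n - 1}"
        have "degree (of_nat (c i) * h i * k i) \<le> degree (of_nat (c i) * h i) + degree (k i)"
          by (rule degree_mult_le)
        also have "degree (of_nat (c i) * h i) \<le> degree (h i)"
          using degree_mult_le[of "of_nat (c i)" "h i"] by simp
        also have "degree (h i) + degree (k i) \<le> (i - 1) div 2 + (n - i - 1) div 2"
          using J[of i] K[of i] i by (intro add_mono) (auto simp: gamma_expansion_def)
        also have "\<dots> \<le> n div 2 - 1" using i True by auto
        finally show "degree (of_nat (c i) * h i * k i) \<le> n div 2 - 1" by simp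
      qed simp
      moreover have "degree (var_tau * ?S) \<le> degree var_tau + degree ?S" by (rule degree_mult_le)
      moreover have "degree var_tau = 1" by (simp add: var_tau_def)
      moreover have "1 \<le> n div 2" using True by simp
      ultimately show ?thesis by linarith
    qed simp
  qed
  have "eval_at a t ((var_alpha + var_t) * H + var_alpha * var_t * (\<Sum>i=1..n-1. of_nat (c i) * J i * K i)) =
      of_int (a + t) ^ n * gamma_value (?x a t) (g + var_tau * ?S)" if at: "a > 0" "t > 0" for a t
  proof -
    let ?s = "real_of_int (a + t)"
    have s: "?s \<noteq> 0" using at by (simp del: of_int_add)
    have "eval_at a t (\<Sum>i=1..n-1. of_nat (c i) * J i * K i) =
        (\<Sum>i=1..n-1. ?s ^ (n - 2) * gamma_value (?x a t) (of_nat (c i) * h i * k i))"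
      unfolding eval_at_sum
    proof (intro sum.cong refl)
      fix i assume i: "i \<in> {1..n - 1}"
      then have "n - 2 = (i - 1) + (n - i - 1)" by auto
      then have "?s ^ (n - 2) = ?s ^ (i - 1) * ?s ^ (n - i - 1)" by (simp only: power_add)
      then show "eval_at a t (of_nat (c i) * J i * K i) = ?s ^ (n - 2) * gamma_value (?x a t) (of_nat (c i) * h i * k i)"
        using i at by (simp add: eval_J eval_K gamma_value_mult gamma_value_of_nat mult_ac del: of_int_add of_int_mult)
    qed
    also have "\<dots> = ?s ^ (n - 2) * gamma_value (?x a t) ?S"
      by (simp add: gamma_value_sum sum_distrib_left)
    finally have sum: "eval_at a t (\<Sum>i=1..n-1. of_nat (c i) * J i * K i) = ?s ^ (n - 2) * gamma_value (?x a t) ?S" .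
    have tail: "of_int (a * t) * (?s ^ (n - 2) * gamma_value (?x a t) ?S) = ?s ^ n * (?x a t * gamma_value (?x a t) ?S)"
    proof (cases "n \<ge> 2")
      case True
      then have "?s ^ n = ?s ^ (n - 2) * ?s\<^sup>2" by (metis le_add_diff_inverse2 power_add)
      then show ?thesis using s by (simp del: of_int_add of_int_mult)
    next
      case False
      then show ?thesis using n by (simp add: gamma_value_def)
    qed
    have "eval_at a t ((var_alpha + var_t) * H + var_alpha * var_t * (\<Sum>i=1..n-1. of_nat (c i) * J i * K i)) =
        ?s * ?s ^ (n - 1) * gamma_value (?x a t) g + of_int (a * t) * (?s ^ (n - 2) * gamma_value (?x a t) ?S)"
      unfolding eval_at_simps(1,3) sum eval_H[OF at] by simp
    also have "?s * ?s ^ (n - 1) = ?s ^ n" using n by (simp flip: power_Suc)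
    finally show ?thesis
      unfolding tail gamma_value_add gamma_value_mult gamma_value_tau by (simp only: distrib_left)
  qed
  with deg show ?thesis unfolding gamma_expansion_def by (simp add: gamma_form_iff)
qed

lemma gamma_expansion_permutohedron:
  "gamma_expansion n (gamma_poly (permutohedron n)) (H_poly (permutohedron n))"
proof -
  have "\<exists>g. gamma_expansion n g (H_poly (permutohedron n))"
  proof (induction n rule: less_induct)
    case (less n)
    show ?case
    proof (cases "n = 0")
      case True
      then show ?thesis using gamma_expansion_one by (auto simp: H_point)
    next
      case False
      then have n: "n \<ge> 1" by simp
      obtain g where g: "\<And>m. m < n \<Longrightarrow> gamma_expansion m (g m) (H_poly (permutohedron m))"
        using less.IH by metis
      show ?thesis
        unfolding H_recursion_permutohedron[OF n]
        by (rule exI, rule gamma_expansion_recursion[OF n, where h = "\<lambda>i. g (i - 1)" and k = "\<lambda>i. g (n - i - 1)"])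
          (use n in \<open>auto intro!: g\<close>)
    qed
  qed
  then show ?thesis
    using gamma_poly_eqI[of _ "permutohedron n"] by (auto simp: gamma_expansion_def convex_dim_permutohedron)
qed

lemma gamma_expansion_stellohedron:
  "gamma_expansion n (gamma_poly (stellohedron n)) (H_poly (stellohedron n))"
proof -
  have "\<exists>g. gamma_expansion n g (H_poly (stellohedron n))"
  proof (induction n rule: less_induct)
    case (less n)
    show ?case
    proof (cases "n = 0")
      case True
      then show ?thesis using gamma_expansion_one by (auto simp: H_point)
    next
      case False
      then have n: "n \<ge> 1" by simp
      obtain g where g: "\<And>m. m < n \<Longrightarrow> gamma_expansion m (g m) (H_poly (stellohedron m))"
        using less.IH by metis
      show ?thesis
        unfolding H_recursion_stellohedron[OF n]
        by (rule exI, rule gamma_expansion_recursion[OF n, where h = "\<lambda>i. g (i - 1)"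
            and k = "\<lambda>i. gamma_poly (permutohedron (n - i - 1))"])
          (use n in \<open>auto intro!: g gamma_expansion_permutohedron\<close>)
    qed
  qed
  then show ?thesis
    using gamma_poly_eqI[of _ "stellohedron n"] by (auto simp: gamma_expansion_def convex_dim_stellohedron)
qed

theorem mainTheorem9:
  fixes n :: nat
  assumes "n \<ge> 1"
  shows "gamma_poly (stellohedron n) =
      gamma_poly (stellohedron (n - 1)) +
      var_tau * (\<Sum>i=1..n-1. of_nat ((n - 1) choose (i - 1)) *
        gamma_poly (stellohedron (i - 1)) * gamma_poly (permutohedron (n - i - 1)))
    \<and> H_poly (stellohedron n) =
      (var_alpha + var_t) * H_poly (stellohedron (n - 1)) +
      var_alpha * var_t * (\<Sum>i=1..n-1. of_nat ((n - 1) choose (i - 1)) *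
        H_poly (stellohedron (i - 1)) * H_poly (permutohedron (n - i - 1)))"
proof
  show H: "H_poly (stellohedron n) =
      (var_alpha + var_t) * H_poly (stellohedron (n - 1)) +
      var_alpha * var_t * (\<Sum>i=1..n-1. of_nat ((n - 1) choose (i - 1)) *
        H_poly (stellohedron (i - 1)) * H_poly (permutohedron (n - i - 1)))"
    by (rule H_recursion_stellohedron[OF assms])
  let ?g = "gamma_poly (stellohedron (n - 1)) +
      var_tau * (\<Sum>i=1..n-1. of_nat ((n - 1) choose (i - 1)) *
        gamma_poly (stellohedron (i - 1)) * gamma_poly (permutohedron (n - i - 1)))"
  have "gamma_expansion n ?g (H_poly (stellohedron n))"
    unfolding H by (rule gamma_expansion_recursion[OF assms gamma_expansion_stellohedron
          gamma_expansion_stellohedron gamma_expansion_permutohedron])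
  then show "gamma_poly (stellohedron n) = ?g"
    using gamma_poly_eqI[of ?g "stellohedron n"]
    by (simp add: gamma_expansion_def convex_dim_stellohedron)
qed

end
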